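(* Let $\Omega\subset\mathbb{H}^1$ be a bounded domain, $f\in L^2(\Omega)$, and let $A:\mathbb{H}^1\to M_{2\times2}(\mathbb{R})$ have bounded, measurable, $Y$-periodic entries and satisfy, for some constants $\alpha,\beta>0$, $\|A(x)v\|\le\beta\|v\|$ and $\langle A(x)v,v\rangle\ge\alpha\|v\|^2$ for all $x\in\mathbb{H}^1$, $v\in\mathbb{R}^2$. Let $(u,u_1)\in H^1_{\mathbb{H}}(\Omega)\times L^2(\Omega;H^1_{\#,\mathbb{H}}(Y)/\mathbb{R})$ be the solution of $$\int_{\Omega\times Y}A(y)\big(\nabla_{\mathbb{H}}u+\nabla_{\mathbb{H},y}u_1\big)\cdot\big(\nabla_{\mathbb{H}}\phi+\nabla_{\mathbb{H},y}\phi_1\big)\,dx\,dy+\int_{\Omega\times Y}u\phi\,dx\,dy=\int_{\Omega\times Y}f\phi\,dx\,dy$$ for all $(\phi,\phi_1)\in H^1_{\mathbb{H}}(\Omega)\times L^2(\Omega;H^1_{\#,\mathbb{H}}(Y)/\mathbb{R})$. For $i=1,2$ let $Z_i\in H^1_{\#,\mathbb{H}}(Y)/\mathbb{R}$ be the solution of the cell problem $$\int_Y A(y)\nabla_{\mathbb{H},y}Z_i(y)\cdot\nabla_{\mathbb{H},y}\xi(y)\,dy=-\int_Y A(y)e_i\cdot\nabla_{\mathbb{H},y}\xi(y)\,dy\qquad\text{for all }\xi\in H^1_{\#,\mathbb{H}}(Y)/\mathbb{R},$$ where $e_1,e_2$ is the standard basis of $\mathbb{R}^2$. Then $u_1(x,y)=\sum_{i=1}^2Z_i(y)X_iu(x)$,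 and $u$ satisfies $$\int_\Omega A_0\nabla_{\mathbb{H}}u\cdot\nabla_{\mathbb{H}}\phi\,dx+|Y|\int_\Omega u\phi\,dx=|Y|\int_\Omega f\phi\,dx\qquad\text{for all }\phi\in H^1_{\mathbb{H}}(\Omega),$$ where $A_0$ is the constant matrix $$A_0=\int_Y A(y)\left(\begin{bmatrix} 1 & 0 \\ 0 & 1 \end{bmatrix}+\begin{bmatrix} Y_1Z_1 & Y_1Z_2 \\ Y_2Z_1 & Y_2Z_2 \end{bmatrix}\right)dy;$$ that is, $u$ is the weak solution of $-\mathrm{div}_{\mathbb{H}}(A_0\nabla_{\mathbb{H}}u)+|Y|u=|Y|f$ in $\Omega$ with the homogeneous Neumann condition on $\partial\Omega$.
   Context: $\mathbb{H}^1$ is $\mathbb{R}^3$ with the group law $p\cdot q=(p_1+q_1,p_2+q_2,p_3+q_3+2(p_2q_1-p_1q_2))$, dilations $\delta_\lambda(x)=(\lambda x_1,\lambda x_2,\lambda^2x_3)$ for $\lambda>0$, and Lebesgue measure $|\cdot|$. The horizontal vector fields are $X_1=\partial_{x_1}+2x_2\partial_{x_3}$ and $X_2=\partial_{x_2}-2x_1\partial_{x_3}$; $\nabla_{\mathbb{H}}f=(X_1f,X_2f)$ and $\mathrm{div}_{\mathbb{H}}(\phi_1,\phi_2)=X_1\phi_1+X_2\phi_2$ (in the distributional sense). $\nabla_{\mathbb{H},y}=(Y_1,Y_2)$ is the same operator in the variable $y$: $Y_1=\partial_{y_1}+2y_2\partial_{y_3}$, $Y_2=\partial_{y_2}-2y_1\partial_{y_3}$.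 $H^1_{\mathbb{H}}(\Omega)=\{f\in L^2(\Omega): X_1f,X_2f\in L^2(\Omega)\}$. $Y=[0,2)^3$. For $k\in\mathbb{Z}^3$, $2k=(2k_1,2k_2,2k_3)$. A function $f$ on $\mathbb{H}^1$ is $Y$-periodic if $f(2k\cdot x)=f(x)$ for all $k\in\mathbb{Z}^3$ and all $x$. $L^2_{\#,\mathbb{H}}(Y)$ is the space of $Y$-periodic functions with $f|_Y\in L^2(Y)$. $H^1_{\#,\mathbb{H}}(Y)$ is the space of $f\in L^2_{\#,\mathbb{H}}(Y)$ such that $X_1f,X_2f\in L^2(\delta_\lambda(Y))$ for all $\lambda>0$, normed by $\|f\|_{L^2(Y)}$ and $\|X_if\|_{L^2(Y)}$; $/\mathbb{R}$ denotes the quotient by constants. *)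

theory Defs
  imports "HOL-Analysis.Analysis"
begin

type_synonym heis = "real ^ 3"

definition heis_mult :: "heis \<Rightarrow> heis \<Rightarrow> heis" (infixl \<open>\<cdot>\<^sub>H\<close> 70) where
  "p \<cdot>\<^sub>H q = vector [p $ 1 + q $ 1, p $ 2 + q $ 2,
                    p $ 3 + q $ 3 + 2 * (p $ 2 * q $ 1 - p $ 1 * q $ 2)]"

definition dil :: "real \<Rightarrow> heis \<Rightarrow> heis" where
  "dil l x = vector [l * x $ 1, l * x $ 2, l\<^sup>2 * x $ 3]"

definition Ycell :: "heis set" where
  "Ycell = {y. \<forall>i. 0 \<le> y $ i \<and> y $ i < 2}"

definition lattice_pt :: "int ^ 3 \<Rightarrow> heis" where
  "lattice_pt k = (\<chi> i. 2 * real_of_int (k $ i))"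

definition Yperiodic :: "(heis \<Rightarrow> 'a) \<Rightarrow> bool" where
  "Yperiodic f \<longleftrightarrow> (\<forall>k x. f (lattice_pt k \<cdot>\<^sub>H x) = f x)"

definition pd :: "3 \<Rightarrow> (heis \<Rightarrow> real) \<Rightarrow> heis \<Rightarrow> real" where
  "pd i f x = frechet_derivative f (at x) (axis i 1)"

primrec C_k :: "nat \<Rightarrow> (heis \<Rightarrow> real) \<Rightarrow> bool" where
  "C_k 0 f \<longleftrightarrow> continuous_on UNIV f"
| "C_k (Suc n) f \<longleftrightarrow> f differentiable_on UNIV \<and> (\<forall>i. C_k n (pd i f))"

definition test_functions :: "heis set \<Rightarrow> (heis \<Rightarrow> real) set" where
  "test_functions \<Omega> =
     {\<phi>. (\<forall>n. C_k n \<phi>) \<and> compact (closure {x. \<phi> x \<noteq> 0}) \<and> closure {x. \<phi> x \<noteq> 0} \<subseteq> \<Omega>}"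

definition hX :: "2 \<Rightarrow> (heis \<Rightarrow> real) \<Rightarrow> heis \<Rightarrow> real" where
  "hX i \<phi> x = (if i = 1 then pd 1 \<phi> x + 2 * x $ 2 * pd 3 \<phi> x
                        else pd 2 \<phi> x - 2 * x $ 1 * pd 3 \<phi> x)"

definition locally_integrable :: "heis set \<Rightarrow> (heis \<Rightarrow> real) \<Rightarrow> bool" where
  "locally_integrable \<Omega> f \<longleftrightarrow> (\<forall>K. compact K \<and> K \<subseteq> \<Omega> \<longrightarrow> f absolutely_integrable_on K)"

text \<open>The fields \<open>hX 1\<close> and \<open>hX 2\<close> are divergence-free, so their formal
  adjoints are \<open>- hX 1\<close> and \<open>- hX 2\<close>; this gives the sign in the distributional derivative.\<close>

definition is_weak_X :: "2 \<Rightarrow> heis set \<Rightarrow> (heis \<Rightarrow> real) \<Rightarrow> (heis \<Rightarrow> real) \<Rightarrow> bool" where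
  "is_weak_X i \<Omega> f g \<longleftrightarrow> locally_integrable \<Omega> f \<and> locally_integrable \<Omega> g \<and>
     (\<forall>\<phi>\<in>test_functions \<Omega>.
        (LINT x|lebesgue_on \<Omega>. f x * hX i \<phi> x) = - (LINT x|lebesgue_on \<Omega>. g x * \<phi> x))"

text \<open>\<open>wX i \<Omega> f\<close> is a representative of the distributional derivative, which is determined only
  up to null sets; it is meaningful only if \<open>is_weak_X i \<Omega> f\<close> is satisfied by some function.\<close>

definition wX :: "2 \<Rightarrow> heis set \<Rightarrow> (heis \<Rightarrow> real) \<Rightarrow> heis \<Rightarrow> real" where
  "wX i \<Omega> f = (SOME g. is_weak_X i \<Omega> f g)"

definition hgrad :: "heis set \<Rightarrow> (heis \<Rightarrow> real) \<Rightarrow> heis \<Rightarrow> real ^ 2" where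
  "hgrad \<Omega> f x = (\<chi> i. wX i \<Omega> f x)"

definition L2 :: "heis set \<Rightarrow> (heis \<Rightarrow> real) set" where
  "L2 \<Omega> = {f. f \<in> borel_measurable (lebesgue_on \<Omega>) \<and> integrable (lebesgue_on \<Omega>) (\<lambda>x. (f x)\<^sup>2)}"

definition H1 :: "heis set \<Rightarrow> (heis \<Rightarrow> real) set" where
  "H1 \<Omega> = {f \<in> L2 \<Omega>. \<forall>i. \<exists>g. is_weak_X i \<Omega> f g \<and> g \<in> L2 \<Omega>}"

definition L2per :: "(heis \<Rightarrow> real) set" where
  "L2per = {f. Yperiodic f \<and> f \<in> L2 Ycell}"

definition H1per :: "(heis \<Rightarrow> real) set" where
  "H1per = {f \<in> L2per. \<forall>i. \<exists>g. is_weak_X i UNIV f g \<and> (\<forall>l>0. g \<in> L2 (dil l ` Ycell))}"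

definition H1per_norm :: "(heis \<Rightarrow> real) \<Rightarrow> real" where
  "H1per_norm f = sqrt ((LINT y|lebesgue_on Ycell. (f y)\<^sup>2)
     + (\<Sum>i\<in>UNIV. LINT y|lebesgue_on Ycell. (wX i UNIV f y)\<^sup>2))"

text \<open>Elements of the quotient of \<open>H1per\<close> by the constants are handled through representatives
  in \<open>H1per\<close>: \<open>quot_eq\<close> is equality and \<open>quot_norm\<close> the norm in the quotient.\<close>

definition quot_eq :: "(heis \<Rightarrow> real) \<Rightarrow> (heis \<Rightarrow> real) \<Rightarrow> bool" where
  "quot_eq f g \<longleftrightarrow> (\<exists>c. AE y in lebesgue. f y = g y + c)"

definition quot_norm :: "(heis \<Rightarrow> real) \<Rightarrow> real" where
  "quot_norm f = (INF c. H1per_norm (\<lambda>y. f y + c))"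

text \<open>The Bochner space of square-integrable maps from \<open>\<Omega>\<close> to the quotient of \<open>H1per\<close> by the
  constants: strongly measurable (an almost everywhere limit, in the quotient norm, of simple
  functions) with square-integrable norm.\<close>

definition L2_H1per_quot :: "heis set \<Rightarrow> (heis \<Rightarrow> heis \<Rightarrow> real) set" where
  "L2_H1per_quot \<Omega> = {w.
     (\<forall>x\<in>\<Omega>. w x \<in> H1per) \<and>
     (\<exists>s :: nat \<Rightarrow> heis \<Rightarrow> heis \<Rightarrow> real.
        (\<forall>n. simple_function (lebesgue_on \<Omega>) (s n) \<and> s n ` \<Omega> \<subseteq> H1per) \<and>
        (AE x in lebesgue_on \<Omega>. (\<lambda>n. quot_norm (\<lambda>y. s n x y - w x y)) \<longlonglongrightarrow> 0)) \<and>
     integrable (lebesgue_on \<Omega>) (\<lambda>x. (quot_norm (w x))\<^sup>2)}"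

text \<open>Integrals over \<open>\<Omega> \<times> Ycell\<close> are iterated: the gradient in \<open>y\<close> of an element \<open>w\<close> of
  \<open>L2_H1per_quot \<Omega>\<close> is, for each \<open>x\<close>, the class of \<open>hgrad UNIV (w x)\<close> in the square-integrable
  fields on \<open>Ycell\<close>, so that the inner integral does not depend on the representatives.\<close>

definition two_scale_solution ::
  "heis set \<Rightarrow> (heis \<Rightarrow> real ^ 2 ^ 2) \<Rightarrow> (heis \<Rightarrow> real) \<Rightarrow> (heis \<Rightarrow> real) \<Rightarrow> (heis \<Rightarrow> heis \<Rightarrow> real) \<Rightarrow> bool" where
  "two_scale_solution \<Omega> A f u u1 \<longleftrightarrow> u \<in> H1 \<Omega> \<and> u1 \<in> L2_H1per_quot \<Omega> \<and>
     (\<forall>\<phi>\<in>H1 \<Omega>. \<forall>\<phi>1\<in>L2_H1per_quot \<Omega>.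
        (LINT x|lebesgue_on \<Omega>. LINT y|lebesgue_on Ycell.
           (A y *v (hgrad \<Omega> u x + hgrad UNIV (u1 x) y)) \<bullet> (hgrad \<Omega> \<phi> x + hgrad UNIV (\<phi>1 x) y))
        + (LINT x|lebesgue_on \<Omega>. LINT y|lebesgue_on Ycell. u x * \<phi> x)
        = (LINT x|lebesgue_on \<Omega>. LINT y|lebesgue_on Ycell. f x * \<phi> x))"

definition cell_solution :: "(heis \<Rightarrow> real ^ 2 ^ 2) \<Rightarrow> 2 \<Rightarrow> (heis \<Rightarrow> real) \<Rightarrow> bool" where
  "cell_solution A i Z \<longleftrightarrow> Z \<in> H1per \<and>
     (\<forall>\<xi>\<in>H1per.
        (LINT y|lebesgue_on Ycell. (A y *v hgrad UNIV Z y) \<bullet> hgrad UNIV \<xi> y)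
        = - (LINT y|lebesgue_on Ycell. (A y *v axis i 1) \<bullet> hgrad UNIV \<xi> y))"

definition effective_matrix :: "(heis \<Rightarrow> real ^ 2 ^ 2) \<Rightarrow> (2 \<Rightarrow> heis \<Rightarrow> real) \<Rightarrow> real ^ 2 ^ 2" where
  "effective_matrix A Z =
     (LINT y|lebesgue_on Ycell. A y ** (mat 1 + (\<chi> i j. wX i UNIV (Z j) y)))"

text \<open>Weak solutions of \<open>- div\<^sub>H (B \<nabla>\<^sub>H u) + c u = g\<close> in \<open>\<Omega>\<close> with homogeneous Neumann condition:
  the test functions range over all of \<open>H1 \<Omega>\<close>.\<close>

definition weak_neumann_solution ::
  "heis set \<Rightarrow> real ^ 2 ^ 2 \<Rightarrow> real \<Rightarrow> (heis \<Rightarrow> real) \<Rightarrow> (heis \<Rightarrow> real) \<Rightarrow> bool" where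
  "weak_neumann_solution \<Omega> B c g u \<longleftrightarrow> u \<in> H1 \<Omega> \<and>
     (\<forall>\<phi>\<in>H1 \<Omega>.
        (LINT x|lebesgue_on \<Omega>. (B *v hgrad \<Omega> u x) \<bullet> hgrad \<Omega> \<phi> x)
        + c * (LINT x|lebesgue_on \<Omega>. u x * \<phi> x)
        = (LINT x|lebesgue_on \<Omega>. g x * \<phi> x))"

end

theory Submission
  imports Defs
begin

text \<open>
  Put \<open>w = u\<^sub>1 - \<Sum>\<^sub>i Z\<^sub>i X\<^sub>i u\<close>, an admissible second component of a test pair. Testing the
  two-scale problem with \<open>(0, w)\<close> and using the cell problems with test function \<open>w x\<close>, all mixed
  terms cancel and the integral over \<open>\<Omega>\<close> of the energies of \<open>w x\<close> vanishes. By coercivity the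
  horizontal gradient of \<open>w x\<close> is zero on the cell for almost every \<open>x\<close>, and since \<open>X\<^sub>1\<close>, \<open>X\<^sub>2\<close>
  and their commutator \<open>-4 \<partial>\<^sub>3\<close> span all directions, \<open>w x\<close> is constant on the cell, hence
  everywhere by periodicity. Testing with \<open>(\<phi>, 0)\<close> and inserting this form of \<open>u\<^sub>1\<close> gives the
  effective equation.

  Weak derivatives are only chosen representatives, so each manipulation of them rests on their
  almost everywhere uniqueness. For this, and for the constancy of functions with vanishing weak
  derivatives on a box, it suffices to test with products of functions of one variable: the integral
  of such a function against a product is proportional to the product of the integrals of the
  factors. Because a Bochner integral of a non-integrable function is zero, the vanishing of the
  energies also needs the measurability of \<open>x \<mapsto> energy (w x)\<close>, which follows from the continuity
  of the energy in the quotient norm.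
\<close>

subsection \<open>Smooth functions of one variable\<close>

primrec times_differentiable :: "nat \<Rightarrow> ('a::real_normed_field \<Rightarrow> 'a) \<Rightarrow> bool" where
  "times_differentiable 0 f \<longleftrightarrow> True"
| "times_differentiable (Suc n) f \<longleftrightarrow>
     (\<forall>x. f field_differentiable at x) \<and> times_differentiable n (deriv f)"

definition smooth :: "('a::real_normed_field \<Rightarrow> 'a) \<Rightarrow> bool" where
  "smooth f \<longleftrightarrow> (\<forall>n. times_differentiable n f)"

lemma times_differentiable_SucI:
  assumes "\<And>x. (f has_field_derivative f' x) (at x)" "times_differentiable n f'"
  shows "times_differentiable (Suc n) f"
proof -
  have "deriv f = f'" using assms(1) by (auto intro: DERIV_imp_deriv)
  then show ?thesis using assms by (auto simp: field_differentiable_def)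
qed

lemma times_differentiable_SucD:
  assumes "times_differentiable (Suc n) f"
  shows "(f has_field_derivative deriv f x) (at x)" "times_differentiable n (deriv f)"
  using assms by (auto simp: field_differentiable_derivI)

lemma times_differentiable_Suc_imp: "times_differentiable (Suc n) f \<Longrightarrow> times_differentiable n f"
  by (induction n arbitrary: f) auto

lemma times_differentiable_const: "times_differentiable n (\<lambda>x. c)"
proof (induction n arbitrary: c)
  case (Suc n)
  show ?case by (rule times_differentiable_SucI[OF _ Suc[of 0]]) simp
qed simp

lemma times_differentiable_add:
  "times_differentiable n f \<Longrightarrow> times_differentiable n g \<Longrightarrow> times_differentiable n (\<lambda>x. f x + g x)"
proof (induction n arbitrary: f g)
  case (Suc n)
  show ?case
    by (rule times_differentiable_SucI[OF DERIV_add])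
      (use Suc times_differentiable_SucD in blast)+
qed simp

lemma times_differentiable_mult:
  "times_differentiable n f \<Longrightarrow> times_differentiable n g \<Longrightarrow> times_differentiable n (\<lambda>x. f x * g x)"
proof (induction n arbitrary: f g)
  case (Suc n)
  have "times_differentiable n (\<lambda>x. deriv f x * g x + deriv g x * f x)"
    by (intro times_differentiable_add Suc.IH)
      (use Suc.prems times_differentiable_SucD times_differentiable_Suc_imp in blast)+
  then show ?case
    by (rule times_differentiable_SucI[rotated])
      (intro DERIV_mult Suc.prems[THEN times_differentiable_SucD(1)])
qed simp

lemma times_differentiable_affine:
  "times_differentiable n f \<Longrightarrow> times_differentiable n (\<lambda>x. f (m * x + b))"
proof (induction n arbitrary: f)
  case (Suc n)
  have "times_differentiable n (\<lambda>x. deriv f (m * x + b) * m)"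
    by (intro times_differentiable_mult times_differentiable_const Suc.IH
        times_differentiable_SucD(2)[OF Suc.prems])
  moreover have "((\<lambda>x. f (m * x + b)) has_field_derivative deriv f (m * x + b) * m) (at x)" for x
    by (rule DERIV_chain2[OF times_differentiable_SucD(1)[OF Suc.prems]])
      (auto intro!: derivative_eq_intros)
  ultimately show ?case by (rule times_differentiable_SucI[rotated])
qed simp

lemma smooth_const: "smooth (\<lambda>x. c)"
  and smooth_add: "smooth f \<Longrightarrow> smooth g \<Longrightarrow> smooth (\<lambda>x. f x + g x)"
  and smooth_mult: "smooth f \<Longrightarrow> smooth g \<Longrightarrow> smooth (\<lambda>x. f x * g x)"
  and smooth_affine: "smooth f \<Longrightarrow> smooth (\<lambda>x. f (m * x + b))"
  by (auto simp: smooth_def times_differentiable_const times_differentiable_add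
      times_differentiable_mult times_differentiable_affine)

lemma smooth_DERIV: "smooth f \<Longrightarrow> (f has_field_derivative deriv f x) (at x)"
  unfolding smooth_def using times_differentiable_SucD(1) by blast

lemma smooth_deriv: "smooth f \<Longrightarrow> smooth (deriv f)"
  unfolding smooth_def using times_differentiable_SucD(2) by blast

lemma smooth_imp_continuous_on: "smooth f \<Longrightarrow> continuous_on S f"
  by (rule DERIV_continuous_on) (blast intro: smooth_DERIV has_field_derivative_at_within)

lemma smooth_if_deriv_smooth:
  assumes "\<And>x. (f has_field_derivative f' x) (at x)" "smooth f'"
  shows "smooth f"
  unfolding smooth_def
proof
  fix n show "times_differentiable n f"
    using times_differentiable_SucI[of f f' "n - 1"] assms
    by (cases n) (auto simp: smooth_def simp del: times_differentiable.simps(2))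
qed

subsection \<open>Bump functions on the line\<close>

text \<open>The family \<open>p(1/x) exp(-1/x)\<close>, extended by zero to \<open>x \<le> 0\<close>, is closed under differentiation.\<close>

definition flat_fun :: "real poly \<Rightarrow> real \<Rightarrow> real" where
  "flat_fun p x = (if x > 0 then poly p (1 / x) * exp (- (1 / x)) else 0)"

lemma poly_times_exp_minus_tendsto_0: "((\<lambda>s. poly p s * exp (- s)) \<longlongrightarrow> 0) at_top" for p :: "real poly"
proof -
  have "((\<lambda>s. \<Sum>i\<le>degree p. coeff p i * (s ^ i / exp s)) \<longlongrightarrow> (\<Sum>i\<le>degree p. coeff p i * 0)) at_top"
    by (intro tendsto_intros tendsto_power_div_exp_0)
  then show ?thesis
    by (simp add: poly_altdef exp_minus sum_divide_distrib divide_inverse sum_distrib_right mult.assoc)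
qed

lemma flat_fun_DERIV_0: "(flat_fun p has_real_derivative 0) (at 0)"
proof -
  have "((\<lambda>x. poly (pCons 0 p) (1 / x) * exp (- (1 / x))) \<longlongrightarrow> 0) (at_right (0::real))"
    using filterlim_compose[OF poly_times_exp_minus_tendsto_0[of "pCons 0 p"] filterlim_inverse_at_top_right]
    by (simp add: inverse_eq_divide)
  then have "((\<lambda>h. flat_fun p h / h) \<longlongrightarrow> 0) (at_right 0)"
    by (rule Lim_transform_eventually)
      (auto simp: flat_fun_def eventually_at_right_less intro!: eventually_mono[OF eventually_at_right_less])
  moreover have "((\<lambda>h. flat_fun p h / h) \<longlongrightarrow> 0) (at_left 0)"
    by (rule Lim_transform_eventually[OF tendsto_const])
      (auto simp: flat_fun_def eventually_at_left_field intro!: exI[of _ "-1"])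
  ultimately show ?thesis
    by (simp add: DERIV_def flat_fun_def filterlim_split_at)
qed

lemma flat_fun_DERIV:
  "(flat_fun p has_real_derivative flat_fun ([:0, 0, 1:] * (p - pderiv p)) x) (at x)"
proof -
  consider (pos) "x > 0" | (neg) "x < 0" | (zero) "x = 0" by linarith
  then show ?thesis
  proof cases
    case pos
    have "((\<lambda>x. poly p (1 / x) * exp (- (1 / x))) has_real_derivative
        flat_fun ([:0, 0, 1:] * (p - pderiv p)) x) (at x)"
      using pos by (auto intro!: derivative_eq_intros DERIV_chain2[OF poly_DERIV]
          simp: flat_fun_def field_simps power2_eq_square)
    then show ?thesis
      by (rule has_field_derivative_transform_within_open[of _ _ _ "{0<..}"])
        (use pos in \<open>auto simp: flat_fun_def\<close>)
  next
    case neg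
    have "((\<lambda>x. 0) has_real_derivative flat_fun ([:0, 0, 1:] * (p - pderiv p)) x) (at x)"
      using neg by (simp add: flat_fun_def)
    then show ?thesis
      by (rule has_field_derivative_transform_within_open[of _ _ _ "{..<0}"])
        (use neg in \<open>auto simp: flat_fun_def\<close>)
  next
    case zero
    then show ?thesis using flat_fun_DERIV_0 by (simp add: flat_fun_def)
  qed
qed

lemma smooth_flat_fun: "smooth (flat_fun p)"
  unfolding smooth_def
proof
  fix n show "times_differentiable n (flat_fun p)"
  proof (induction n arbitrary: p)
    case (Suc n)
    show ?case by (rule times_differentiable_SucI[OF flat_fun_DERIV Suc])
  qed simp
qed

lemma flat_fun_1_tendsto_1:
  assumes "y > 0" shows "(\<lambda>n. flat_fun 1 (real n * y)) \<longlonglongrightarrow> 1"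
proof -
  have "(\<lambda>n. exp (- (inverse (real n) * (1 / y)))) \<longlonglongrightarrow> exp (- (0 * (1 / y)))"
    by (intro tendsto_intros lim_inverse_n)
  then have "(\<lambda>n. exp (- (inverse (real n) * (1 / y)))) \<longlonglongrightarrow> 1" by simp
  then show ?thesis
    by (rule Lim_transform_eventually)
      (use assms in \<open>auto simp: flat_fun_def field_simps intro!: eventually_mono[OF eventually_gt_at_top[of 0]]\<close>)
qed

definition bump :: "nat \<Rightarrow> real \<Rightarrow> real \<Rightarrow> real \<Rightarrow> real" where
  "bump n p q x = flat_fun 1 (real n * (x - p)) * flat_fun 1 (real n * (q - x))"

lemma smooth_bump: "smooth (bump n p q)"
proof -
  have "smooth (\<lambda>x. flat_fun 1 (real n * x + (- real n * p)) * flat_fun 1 ((- real n) * x + real n * q))"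
    by (intro smooth_mult smooth_affine smooth_flat_fun)
  then show ?thesis by (simp add: bump_def[abs_def] algebra_simps)
qed

lemma bump_nonneg: "0 \<le> bump n p q x"
  and bump_le_1: "bump n p q x \<le> 1"
  and bump_pos: "n > 0 \<Longrightarrow> p < x \<Longrightarrow> x < q \<Longrightarrow> 0 < bump n p q x"
  by (auto simp: bump_def flat_fun_def mult_le_one)

lemma bump_eq_0:
  assumes "x \<notin> {p<..<q}" shows "bump n p q x = 0"
proof -
  have "real n * (x - p) \<le> 0 \<or> real n * (q - x) \<le> 0"
    using assms by (auto simp: mult_le_0_iff)
  then show ?thesis by (auto simp: bump_def flat_fun_def)
qed

lemma bump_tendsto_indicator: "(\<lambda>n. bump n p q x) \<longlonglongrightarrow> indicator {p<..<q} x"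
proof (cases "x \<in> {p<..<q}")
  case True
  then show ?thesis unfolding bump_def
    using tendsto_mult[OF flat_fun_1_tendsto_1[of "x - p"] flat_fun_1_tendsto_1[of "q - x"]] by simp
qed (simp add: bump_eq_0)

subsection \<open>Test functions on an interval\<close>

definition interval_test_functions :: "real \<Rightarrow> real \<Rightarrow> (real \<Rightarrow> real) set" where
  "interval_test_functions l r =
     {f. smooth f \<and> (\<exists>p q. l < p \<and> q < r \<and> (\<forall>t. t \<notin> {p..q} \<longrightarrow> f t = 0))}"

lemma interval_test_functionsE:
  assumes "f \<in> interval_test_functions l r"
  obtains p q where "l < p" "q < r" "\<And>t. t \<notin> {p..q} \<Longrightarrow> f t = 0"
  using assms by (auto simp: interval_test_functions_def)

lemma interval_test_functions_smooth: "f \<in> interval_test_functions l r \<Longrightarrow> smooth f"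
  by (simp add: interval_test_functions_def)

lemma bump_in_interval_test_functions:
  "l < p \<Longrightarrow> q < r \<Longrightarrow> bump n p q \<in> interval_test_functions l r"
  unfolding interval_test_functions_def using smooth_bump bump_eq_0[of _ p q n]
  by (intro CollectI conjI exI[of _ p] exI[of _ q]) auto

lemma interval_test_functions_linear:
  assumes "f \<in> interval_test_functions l r" "g \<in> interval_test_functions l r"
  shows "(\<lambda>t. a * f t + b * g t) \<in> interval_test_functions l r"
proof -
  obtain p q p' q' where supp: "l < p" "q < r" "\<And>t. t \<notin> {p..q} \<Longrightarrow> f t = 0"
    "l < p'" "q' < r" "\<And>t. t \<notin> {p'..q'} \<Longrightarrow> g t = 0"
    using assms interval_test_functionsE by metis
  have "smooth (\<lambda>t. a * f t + b * g t)"
    by (intro smooth_add smooth_mult smooth_const assms[THEN interval_test_functions_smooth])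
  moreover have "a * f t + b * g t = 0" if "t \<notin> {min p p'..max q q'}" for t
    using that supp(3)[of t] supp(6)[of t] by force
  ultimately show ?thesis unfolding interval_test_functions_def using supp
    by (intro CollectI conjI exI[of _ "min p p'"] exI[of _ "max q q'"]) auto
qed

lemma interval_test_function_integral_1:
  assumes "l < r"
  obtains e where "e \<in> interval_test_functions l r" "integral {l..r} e = 1"
proof -
  define f where "f = bump 1 ((2 * l + r) / 3) ((l + 2 * r) / 3)"
  have f: "f \<in> interval_test_functions l r"
    unfolding f_def using assms by (intro bump_in_interval_test_functions) auto
  define I where "I = integral {l..r} f"
  have "0 < f ((l + r) / 2)"
    unfolding f_def using assms by (intro bump_pos) (auto simp: field_simps)
  then have "\<not> (\<forall>t\<in>{l..r}. f t = 0)"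
    using assms by (intro notI) (auto dest!: bspec[of _ _ "(l + r) / 2"])
  then have "I \<noteq> 0"
    unfolding I_def using assms bump_nonneg
    by (subst integral_eq_0_iff) (auto simp: f_def intro: smooth_imp_continuous_on smooth_bump)
  show thesis
  proof (rule that)
    show "(\<lambda>t. inverse I * f t + 0 * f t) \<in> interval_test_functions l r"
      by (rule interval_test_functions_linear[OF f f])
    show "integral {l..r} (\<lambda>t. inverse I * f t + 0 * f t) = 1"
      using \<open>I \<noteq> 0\<close> by (simp add: I_def)
  qed
qed

lemma smooth_antiderivative:
  fixes f :: "real \<Rightarrow> real"
  assumes "smooth f"
  obtains F where "smooth F" "\<And>t. (F has_real_derivative f t) (at t)"
proof -
  have "isCont f x" for x
    using smooth_imp_continuous_on[OF assms, of UNIV] by (simp add: continuous_on_eq_continuous_at)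
  then have "\<exists>F. \<forall>x::real. -\<infinity> < ereal x \<longrightarrow> ereal x < \<infinity> \<longrightarrow> (F has_vector_derivative f x) (at x)"
    by (intro einterval_antiderivative) auto
  then obtain F where F: "\<And>t. (F has_real_derivative f t) (at t)"
    by (auto simp: has_real_derivative_iff_has_vector_derivative)
  with assms show thesis using smooth_if_deriv_smooth that by blast
qed

lemma interval_test_function_antiderivative:
  assumes f: "f \<in> interval_test_functions l r" and "l < r" and "integral {l..r} f = 0"
  obtains F where "F \<in> interval_test_functions l r" "deriv F = f"
proof -
  obtain p q where supp: "l < p" "q < r" "\<And>t. t \<notin> {p..q} \<Longrightarrow> f t = 0"
    using f interval_test_functionsE by metis
  obtain F where F: "smooth F" "\<And>t. (F has_real_derivative f t) (at t)"
    using smooth_antiderivative[OF interval_test_functions_smooth[OF f]] by metis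
  have "(f has_integral F r - F l) {l..r}"
    using \<open>l < r\<close> F(2) by (intro fundamental_theorem_of_calculus)
      (auto simp: has_real_derivative_iff_has_vector_derivative intro: has_vector_derivative_at_within)
  then have "F r = F l" using assms(3) by (simp add: integral_unique)
  have const: "F s = F t" if "convex S" "S \<inter> {p..q} = {}" "s \<in> S" "t \<in> S" for S s t
  proof -
    have "(F has_real_derivative 0) (at x within S)" if "x \<in> S" for x
      using F(2)[of x] supp(3)[of x] that \<open>S \<inter> {p..q} = {}\<close>
      by (metis disjoint_iff has_field_derivative_at_within)
    then show ?thesis
      using has_field_derivative_zero_constant[OF \<open>convex S\<close>] that(3,4) by metis
  qed
  have "F t - F l = 0" if "t \<notin> {p..q}" for t
  proof -
    have "F t = F l" if "t < p" by (rule const[of "{..<p}"]) (use that supp in auto)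
    moreover have "F t = F r" if "q < t" by (rule const[of "{q<..}"]) (use that supp in auto)
    ultimately show ?thesis using that \<open>F r = F l\<close> by (cases "t < p") auto
  qed
  moreover have "smooth (\<lambda>t. F t - F l)" using smooth_add[OF F(1) smooth_const[of "- F l"]] by simp
  ultimately have "(\<lambda>t. F t - F l) \<in> interval_test_functions l r"
    unfolding interval_test_functions_def using supp(1,2) by blast
  moreover have "((\<lambda>t. F t - F l) has_real_derivative f t) (at t)" for t
    using DERIV_diff[OF F(2)[of t] DERIV_const[of "F l"]] by simp
  then have "deriv (\<lambda>t. F t - F l) = f" by (intro ext DERIV_imp_deriv)
  ultimately show thesis by (rule that)
qed

lemma linear_functional_proportional_to_integral:
  fixes L :: "(real \<Rightarrow> real) \<Rightarrow> real"
  assumes linear: "\<And>f g a b. f \<in> interval_test_functions l r \<Longrightarrow> g \<in> interval_test_functions l r \<Longrightarrow>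
      L (\<lambda>t. a * f t + b * g t) = a * L f + b * L g"
    and L_deriv: "\<And>f. f \<in> interval_test_functions l r \<Longrightarrow> L (deriv f) = 0"
    and "l < r" and e: "e \<in> interval_test_functions l r" "integral {l..r} e = 1"
    and f: "f \<in> interval_test_functions l r"
  shows "L f = integral {l..r} f * L e"
proof -
  let ?g = "\<lambda>t. 1 * f t + (- integral {l..r} f) * e t"
  have cont: "continuous_on {l..r} f" "continuous_on {l..r} e"
    using f e by (auto intro: smooth_imp_continuous_on interval_test_functions_smooth)
  have "integral {l..r} ?g = integral {l..r} f - integral {l..r} f * integral {l..r} e"
    using cont by (subst integral_add) (auto intro!: integrable_continuous_real continuous_intros)
  then have "integral {l..r} ?g = 0" using e(2) by simp
  moreover have "?g \<in> interval_test_functions l r" by (rule interval_test_functions_linear[OF f e(1)])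
  ultimately obtain F where "F \<in> interval_test_functions l r" "deriv F = ?g"
    using interval_test_function_antiderivative[OF _ \<open>l < r\<close>] by metis
  then have "L ?g = 0" using L_deriv by metis
  then show ?thesis using linear[OF f e(1), of 1 "- integral {l..r} f"] by simp
qed

subsection \<open>Partial derivatives and smooth functions on the group\<close>

lemma pd_eqI: "(f has_derivative f') (at x) \<Longrightarrow> pd i f x = f' (axis i 1)"
  by (simp add: pd_def frechet_derivative_at[symmetric])

lemma pd_const: "pd i (\<lambda>x. c) x = 0"
  by (rule pd_eqI[OF has_derivative_const])

lemma pd_nth: "pd i (\<lambda>x. x $ j) x = (if i = j then 1 else 0)"
  using pd_eqI[OF bounded_linear_imp_has_derivative[OF bounded_linear_vec_nth[of j]], of i x]
  by (auto simp: axis_def)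

lemma
  assumes "f differentiable at x" "g differentiable at x"
  shows pd_add: "pd i (\<lambda>x. f x + g x) x = pd i f x + pd i g x"
    and pd_mult: "pd i (\<lambda>x. f x * g x) x = f x * pd i g x + pd i f x * g x"
  using pd_eqI[OF has_derivative_add] pd_eqI[OF has_derivative_mult] assms
  by (auto simp: pd_def frechet_derivative_works)

lemma pd_eq_0_outside_support:
  assumes "closed K" "\<And>x. x \<notin> K \<Longrightarrow> f x = 0" "x \<notin> K"
  shows "pd i f x = 0"
proof -
  have "(f has_derivative (\<lambda>h. 0)) (at x)"
    by (rule has_derivative_transform_within_open[OF has_derivative_const, of "- K"]) (use assms in auto)
  from pd_eqI[OF this] show ?thesis .
qed

lemma pd_DERIV:
  assumes "f differentiable_on UNIV"
  shows "((\<lambda>s. f (x + s *\<^sub>R axis i 1)) has_real_derivative pd i f (x + s *\<^sub>R axis i 1)) (at s)"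
proof -
  let ?D = "frechet_derivative f (at (x + s *\<^sub>R axis i 1))"
  have deriv: "(f has_derivative ?D) (at (x + s *\<^sub>R axis i 1))"
    using assms by (simp add: differentiable_on_def frechet_derivative_works)
  have "((\<lambda>s. x + s *\<^sub>R axis i 1) has_derivative (\<lambda>h. h *\<^sub>R axis i 1)) (at s)"
    by (auto intro!: derivative_eq_intros)
  from has_derivative_compose[OF this deriv] show ?thesis
    by (simp add: has_field_derivative_def pd_def linear_cmul[OF has_derivative_linear[OF deriv]] mult_commute_abs)
qed

lemma C_k_Suc_imp: "C_k (Suc n) f \<Longrightarrow> C_k n f"
  by (induction n arbitrary: f) (auto intro: differentiable_imp_continuous_on)

lemma C_k_Suc_differentiable: "C_k (Suc n) f \<Longrightarrow> f differentiable at x"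
  by (simp add: differentiable_on_def)

lemma C_k_const: "C_k n (\<lambda>x. c)"
  by (induction n arbitrary: c) (auto simp: pd_const[abs_def])

lemma C_k_nth: "C_k n (\<lambda>x. x $ i)"
proof (cases n)
  case (Suc m)
  have "pd j (\<lambda>x. x $ i) = (\<lambda>x. if j = i then 1 else 0)" for j by (simp add: pd_nth fun_eq_iff)
  then show ?thesis
    unfolding Suc by (auto simp: C_k_const differentiable_on_def
        intro: bounded_linear_imp_differentiable bounded_linear_vec_nth)
qed (auto intro: continuous_intros)

lemma C_k_add: "C_k n f \<Longrightarrow> C_k n g \<Longrightarrow> C_k n (\<lambda>x. f x + g x)"
proof (induction n arbitrary: f g)
  case (Suc n)
  have "pd i (\<lambda>x. f x + g x) = (\<lambda>x. pd i f x + pd i g x)" for i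
    using Suc.prems by (intro ext pd_add C_k_Suc_differentiable)
  then show ?case using Suc by simp
qed (auto intro: continuous_intros)

lemma C_k_mult: "C_k n f \<Longrightarrow> C_k n g \<Longrightarrow> C_k n (\<lambda>x. f x * g x)"
proof (induction n arbitrary: f g)
  case (Suc n)
  have "pd i (\<lambda>x. f x * g x) = (\<lambda>x. f x * pd i g x + pd i f x * g x)" for i
    using Suc.prems by (intro ext pd_mult C_k_Suc_differentiable)
  moreover have "C_k n f" "C_k n g" using Suc.prems by (auto intro: C_k_Suc_imp)
  ultimately show ?case using Suc by (simp add: C_k_add)
qed (auto intro: continuous_intros)

lemma mixed_second_difference:
  assumes f: "f differentiable_on UNIV" "pd i f differentiable_on UNIV" and "h > 0"
  obtains \<xi> where "dist \<xi> x \<le> 2 * h"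
    "f (x + h *\<^sub>R axis j 1 + h *\<^sub>R axis i 1) - f (x + h *\<^sub>R axis i 1) - f (x + h *\<^sub>R axis j 1) + f x
      = h\<^sup>2 * pd j (pd i f) \<xi>"
proof -
  let ?d = "\<lambda>s. f (x + h *\<^sub>R axis j 1 + s *\<^sub>R axis i 1) - f (x + s *\<^sub>R axis i 1)"
  have "(?d has_real_derivative pd i f (x + h *\<^sub>R axis j 1 + s *\<^sub>R axis i 1)
      - pd i f (x + s *\<^sub>R axis i 1)) (at s)" for s
    by (intro DERIV_diff pd_DERIV f(1))
  from MVT2[OF \<open>h > 0\<close> this] obtain s where s: "0 < s" "s < h"
    "?d h - ?d 0 = h * (pd i f (x + h *\<^sub>R axis j 1 + s *\<^sub>R axis i 1) - pd i f (x + s *\<^sub>R axis i 1))"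
    by auto
  have "((\<lambda>t. pd i f (x + s *\<^sub>R axis i 1 + t *\<^sub>R axis j 1)) has_real_derivative
      pd j (pd i f) (x + s *\<^sub>R axis i 1 + t *\<^sub>R axis j 1)) (at t)" for t
    by (intro pd_DERIV f(2))
  from MVT2[OF \<open>h > 0\<close> this] obtain t where t: "0 < t" "t < h"
    "pd i f (x + s *\<^sub>R axis i 1 + h *\<^sub>R axis j 1) - pd i f (x + s *\<^sub>R axis i 1)
      = h * pd j (pd i f) (x + s *\<^sub>R axis i 1 + t *\<^sub>R axis j 1)"
    by auto
  show thesis
  proof (rule that)
    have "norm (s *\<^sub>R axis i (1::real) + t *\<^sub>R axis j 1 :: heis) \<le> s + t"
      using s(1) t(1) norm_triangle_ineq[of "s *\<^sub>R axis i (1::real)" "t *\<^sub>R axis j 1 :: heis"] by simp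
    then show "dist (x + s *\<^sub>R axis i 1 + t *\<^sub>R axis j 1) x \<le> 2 * h"
      using s(2) t(2) by (simp add: dist_norm add.assoc)
    show "f (x + h *\<^sub>R axis j 1 + h *\<^sub>R axis i 1) - f (x + h *\<^sub>R axis i 1) - f (x + h *\<^sub>R axis j 1) + f x
        = h\<^sup>2 * pd j (pd i f) (x + s *\<^sub>R axis i 1 + t *\<^sub>R axis j 1)"
      using s(3) t(3) by (simp add: algebra_simps power2_eq_square)
  qed
qed

lemma pd_commute:
  assumes f: "C_k 2 f"
  shows "pd i (pd j f) x = pd j (pd i f) x"
proof -
  have diff: "f differentiable_on UNIV" "pd k f differentiable_on UNIV"
    and cont: "continuous_on UNIV (pd l (pd k f))" for k l
    using f by (simp_all add: numeral_2_eq_2)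
  define h where "h n = inverse (real (Suc n))" for n
  have h_pos: "h n > 0" for n by (simp add: h_def)
  have "\<exists>\<xi> \<zeta>. dist \<xi> x \<le> 2 * h n \<and> dist \<zeta> x \<le> 2 * h n \<and> pd j (pd i f) \<xi> = pd i (pd j f) \<zeta>" for n
  proof -
    obtain \<xi> where \<xi>: "dist \<xi> x \<le> 2 * h n"
      "f (x + h n *\<^sub>R axis j 1 + h n *\<^sub>R axis i 1) - f (x + h n *\<^sub>R axis i 1) - f (x + h n *\<^sub>R axis j 1) + f x
        = (h n)\<^sup>2 * pd j (pd i f) \<xi>"
      by (rule mixed_second_difference[OF diff h_pos])
    obtain \<zeta> where \<zeta>: "dist \<zeta> x \<le> 2 * h n"
      "f (x + h n *\<^sub>R axis i 1 + h n *\<^sub>R axis j 1) - f (x + h n *\<^sub>R axis j 1) - f (x + h n *\<^sub>R axis i 1) + f x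
        = (h n)\<^sup>2 * pd i (pd j f) \<zeta>"
      by (rule mixed_second_difference[OF diff h_pos])
    have "(h n)\<^sup>2 * pd j (pd i f) \<xi> = (h n)\<^sup>2 * pd i (pd j f) \<zeta>"
      unfolding \<xi>(2)[symmetric] \<zeta>(2)[symmetric] by (simp add: algebra_simps)
    then show ?thesis using \<xi>(1) \<zeta>(1) h_pos[of n] by auto
  qed
  then obtain \<xi> \<zeta> where near: "\<And>n. dist (\<xi> n) x \<le> 2 * h n" "\<And>n. dist (\<zeta> n) x \<le> 2 * h n"
    and eq: "\<And>n. pd j (pd i f) (\<xi> n) = pd i (pd j f) (\<zeta> n)"
    by metis
  have lim: "(\<lambda>n. pd k (pd l f) (\<sigma> n)) \<longlonglongrightarrow> pd k (pd l f) x" if "\<And>n. dist (\<sigma> n) x \<le> 2 * h n" for \<sigma> k l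
  proof -
    have "(\<lambda>n. 2 * h n) \<longlonglongrightarrow> 0"
      unfolding h_def by (intro tendsto_mult_right_zero LIMSEQ_inverse_real_of_nat)
    then have "(\<lambda>n. dist (\<sigma> n) x) \<longlonglongrightarrow> 0"
      by (rule Lim_null_comparison[rotated]) (simp add: that)
    then have "\<sigma> \<longlonglongrightarrow> x" by (subst tendsto_dist_iff)
    moreover have "isCont (pd k (pd l f)) x"
      using cont by (simp add: continuous_on_eq_continuous_at)
    ultimately show ?thesis by (rule isCont_tendsto_compose[rotated])
  qed
  show ?thesis
    using LIMSEQ_unique[OF lim[of \<zeta> i j] lim[of \<xi> j i, unfolded eq]] near by blast
qed

definition C_infinity :: "(heis \<Rightarrow> real) \<Rightarrow> bool" where
  "C_infinity f \<longleftrightarrow> (\<forall>n. C_k n f)"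

lemma C_infinity_const: "C_infinity (\<lambda>x. c)"
  and C_infinity_nth: "C_infinity (\<lambda>x. x $ i)"
  and C_infinity_add: "C_infinity f \<Longrightarrow> C_infinity g \<Longrightarrow> C_infinity (\<lambda>x. f x + g x)"
  and C_infinity_mult: "C_infinity f \<Longrightarrow> C_infinity g \<Longrightarrow> C_infinity (\<lambda>x. f x * g x)"
  by (simp_all add: C_infinity_def C_k_const C_k_nth C_k_add C_k_mult)

lemma C_infinity_diff: "C_infinity f \<Longrightarrow> C_infinity g \<Longrightarrow> C_infinity (\<lambda>x. f x - g x)"
  using C_infinity_add[OF _ C_infinity_mult[OF C_infinity_const[of "-1"]], of f g] by simp

lemma C_infinity_pd: "C_infinity f \<Longrightarrow> C_infinity (pd i f)"
  unfolding C_infinity_def using C_k.simps(2) by blast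

lemma C_infinity_differentiable: "C_infinity f \<Longrightarrow> f differentiable at x"
  unfolding C_infinity_def using C_k_Suc_differentiable by blast

lemma C_infinity_continuous_on: "C_infinity f \<Longrightarrow> continuous_on S f"
  unfolding C_infinity_def using C_k.simps(1) continuous_on_subset by blast

subsection \<open>Test functions and the commutator of the horizontal fields\<close>

lemma hX_eq:
  "hX 1 \<phi> = (\<lambda>x. pd 1 \<phi> x + 2 * x $ 2 * pd 3 \<phi> x)"
  "hX 2 \<phi> = (\<lambda>x. pd 2 \<phi> x - 2 * x $ 1 * pd 3 \<phi> x)"
  by (simp_all add: hX_def fun_eq_iff)

lemma C_infinity_hX: "C_infinity \<phi> \<Longrightarrow> C_infinity (hX i \<phi>)"
  using exhaust_2[of i]
  by (auto simp: hX_eq intro!: C_infinity_add C_infinity_diff C_infinity_mult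
      C_infinity_const C_infinity_nth C_infinity_pd)

lemma pd_nth_mult:
  assumes "\<phi> differentiable at x"
  shows "pd i (\<lambda>x. x $ j * \<phi> x) x = x $ j * pd i \<phi> x + (if i = j then \<phi> x else 0)"
  using pd_mult[OF _ assms, of "\<lambda>x. x $ j" i]
  by (simp add: pd_nth C_infinity_differentiable C_infinity_nth)

lemma hX_divergence_form:
  assumes "C_infinity \<phi>"
  shows "hX 1 \<phi> x = pd 1 \<phi> x + 2 * pd 3 (\<lambda>x. x $ 2 * \<phi> x) x"
    "hX 2 \<phi> x = pd 2 \<phi> x - 2 * pd 3 (\<lambda>x. x $ 1 * \<phi> x) x"
  using assms by (simp_all add: hX_eq pd_nth_mult C_infinity_differentiable)

lemma pd_hX:
  assumes "C_infinity \<phi>"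
  shows "pd j (hX 1 \<phi>) x = pd j (pd 1 \<phi>) x + 2 * (x $ 2 * pd j (pd 3 \<phi>) x + (if j = 2 then pd 3 \<phi> x else 0))"
    "pd j (hX 2 \<phi>) x = pd j (pd 2 \<phi>) x - 2 * (x $ 1 * pd j (pd 3 \<phi>) x + (if j = 1 then pd 3 \<phi> x else 0))"
proof -
  have "pd j (\<lambda>x. pd k \<phi> x + c * (x $ l * pd 3 \<phi> x)) x
      = pd j (pd k \<phi>) x + c * (x $ l * pd j (pd 3 \<phi>) x + (if j = l then pd 3 \<phi> x else 0))" for k l c
  proof -
    have [simp]: "pd m \<phi> differentiable at x" "(\<lambda>x. x $ l * pd m \<phi> x) differentiable at x" for m x
      using assms by (auto intro!: C_infinity_differentiable C_infinity_mult C_infinity_nth C_infinity_pd)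
    show ?thesis by (simp add: pd_add pd_mult pd_const pd_nth_mult)
  qed
  from this[of 1 2 2] this[of 2 "-2" 1] show
    "pd j (hX 1 \<phi>) x = pd j (pd 1 \<phi>) x + 2 * (x $ 2 * pd j (pd 3 \<phi>) x + (if j = 2 then pd 3 \<phi> x else 0))"
    "pd j (hX 2 \<phi>) x = pd j (pd 2 \<phi>) x - 2 * (x $ 1 * pd j (pd 3 \<phi>) x + (if j = 1 then pd 3 \<phi> x else 0))"
    by (simp_all add: hX_eq mult.assoc)
qed

lemma hX_commutator:
  assumes "C_infinity \<phi>"
  shows "hX 1 (hX 2 \<phi>) x - hX 2 (hX 1 \<phi>) x = - 4 * pd 3 \<phi> x"
proof -
  have "pd i (pd j \<phi>) x = pd j (pd i \<phi>) x" for i j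
    using assms by (intro pd_commute) (simp add: C_infinity_def)
  then show ?thesis
    unfolding hX_eq(1)[of "hX 2 \<phi>"] hX_eq(2)[of "hX 1 \<phi>"] pd_hX[OF assms]
    by (simp add: algebra_simps)
qed

lemma test_functionsI:
  assumes "C_infinity \<phi>" and K: "compact K" "K \<subseteq> \<Omega>" "\<And>x. x \<notin> K \<Longrightarrow> \<phi> x = 0"
  shows "\<phi> \<in> test_functions \<Omega>"
proof -
  have "closure {x. \<phi> x \<noteq> 0} \<subseteq> K"
    by (rule closure_minimal) (use K compact_imp_closed in auto)
  moreover from this have "compact (closure {x. \<phi> x \<noteq> 0})"
    using K(1) by (meson bounded_subset closed_closure compact_eq_bounded_closed)
  ultimately show ?thesis
    using assms by (auto simp: test_functions_def C_infinity_def)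
qed

lemma test_functionsE:
  assumes "\<phi> \<in> test_functions \<Omega>"
  obtains K where "compact K" "K \<subseteq> \<Omega>" "\<And>x. x \<notin> K \<Longrightarrow> \<phi> x = 0"
proof
  show "compact (closure {x. \<phi> x \<noteq> 0})" "closure {x. \<phi> x \<noteq> 0} \<subseteq> \<Omega>"
    using assms by (simp_all add: test_functions_def)
  show "\<phi> x = 0" if "x \<notin> closure {x. \<phi> x \<noteq> 0}" for x
    using that closure_subset[of "{x. \<phi> x \<noteq> 0}"] by auto
qed

lemma test_functions_C_infinity: "\<phi> \<in> test_functions \<Omega> \<Longrightarrow> C_infinity \<phi>"
  by (simp add: test_functions_def C_infinity_def)

lemma test_functions_mono: "\<Omega>' \<subseteq> \<Omega> \<Longrightarrow> test_functions \<Omega>' \<subseteq> test_functions \<Omega>"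
  by (auto simp: test_functions_def)

lemma nth_mult_in_test_functions:
  assumes "\<phi> \<in> test_functions \<Omega>"
  shows "(\<lambda>x. x $ i * \<phi> x) \<in> test_functions \<Omega>"
proof -
  obtain K where "compact K" "K \<subseteq> \<Omega>" "\<And>x. x \<notin> K \<Longrightarrow> \<phi> x = 0"
    using assms test_functionsE by metis
  then show ?thesis using test_functions_C_infinity[OF assms]
    by (intro test_functionsI[where K=K] C_infinity_mult C_infinity_nth) auto
qed

lemma
  assumes "\<phi> \<in> test_functions \<Omega>"
  shows pd_in_test_functions: "pd j \<phi> \<in> test_functions \<Omega>"
    and hX_in_test_functions: "hX i \<phi> \<in> test_functions \<Omega>"
proof -
  obtain K where K: "compact K" "K \<subseteq> \<Omega>" "\<And>x. x \<notin> K \<Longrightarrow> \<phi> x = 0"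
    using assms test_functionsE by metis
  have "pd j \<phi> x = 0" if "x \<notin> K" for j x
    using pd_eq_0_outside_support[OF compact_imp_closed[OF K(1)] K(3) that] .
  then have "pd j \<phi> x = 0" "hX i \<phi> x = 0" if "x \<notin> K" for x
    using that by (simp_all add: hX_def)
  then show "pd j \<phi> \<in> test_functions \<Omega>" "hX i \<phi> \<in> test_functions \<Omega>"
    using test_functions_C_infinity[OF assms] K(1,2)
    by (auto intro!: test_functionsI[where K=K] C_infinity_pd C_infinity_hX)
qed

subsection \<open>Tensor products of functions of one variable\<close>

definition tensor :: "('n::finite \<Rightarrow> real \<Rightarrow> real) \<Rightarrow> real ^ 'n \<Rightarrow> real" where
  "tensor f x = (\<Prod>i\<in>UNIV. f i (x $ i))"

lemma tensor_fun_upd: "tensor (f(i := g)) x = g (x $ i) * (\<Prod>j\<in>UNIV - {i}. f j (x $ j))"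
  unfolding tensor_def by (subst prod.remove[of _ i]) auto

lemma tensor_has_derivative:
  assumes "\<And>i. smooth (f i)"
  shows "(tensor f has_derivative (\<lambda>h. \<Sum>i\<in>UNIV. h $ i * tensor (f(i := deriv (f i))) x)) (at x)"
proof -
  have "((\<lambda>x. f i (x $ i)) has_derivative (\<lambda>h. deriv (f i) (x $ i) * h $ i)) (at x)" for i
    using has_derivative_compose[OF bounded_linear_imp_has_derivative[OF bounded_linear_vec_nth]
        smooth_DERIV[OF assms, unfolded has_field_derivative_def]] .
  then have "((\<lambda>x. \<Prod>i\<in>UNIV. f i (x $ i)) has_derivative
      (\<lambda>h. \<Sum>i\<in>UNIV. deriv (f i) (x $ i) * h $ i * (\<Prod>j\<in>UNIV - {i}. f j (x $ j)))) (at x)"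
    by (rule has_derivative_prod)
  then show ?thesis by (simp only: tensor_fun_upd tensor_def[of f, abs_def] ac_simps)
qed

lemma continuous_on_tensor:
  assumes "\<And>i. smooth (f i)" shows "continuous_on S (tensor f)"
  by (intro continuous_at_imp_continuous_on ballI has_derivative_continuous[OF tensor_has_derivative] assms)

lemma pd_tensor:
  assumes "\<And>i. smooth (f i)"
  shows "pd i (tensor f) = tensor (f(i := deriv (f i)))"
proof
  fix x
  have "(\<Sum>j\<in>UNIV. axis i 1 $ j * tensor (f(j := deriv (f j))) x) = tensor (f(i := deriv (f i))) x"
    by (simp add: axis_def if_distrib[of "\<lambda>a. a * _"] cong: if_cong)
  then show "pd i (tensor f) x = tensor (f(i := deriv (f i))) x"
    using pd_eqI[OF tensor_has_derivative[of f, OF assms]] by simp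
qed

lemma C_infinity_tensor:
  assumes "\<And>i. smooth (f i)" shows "C_infinity (tensor f)"
proof -
  have "C_k n (tensor f)" for n
    using assms
  proof (induction n arbitrary: f)
    case 0
    then show ?case by (simp add: continuous_on_tensor)
  next
    case (Suc n)
    have "tensor f differentiable_on UNIV"
      using tensor_has_derivative[of f, OF Suc.prems]
      by (meson differentiableI differentiable_at_imp_differentiable_on)
    moreover have "C_k n (pd i (tensor f))" for i
      unfolding pd_tensor[of f, OF Suc.prems] by (rule Suc.IH) (use Suc.prems smooth_deriv in auto)
    ultimately show ?case by simp
  qed
  then show ?thesis by (simp add: C_infinity_def)
qed

lemma tensor_eq_0_outside_cbox:
  assumes "\<And>i t. t \<notin> {p $ i..q $ i} \<Longrightarrow> f i t = 0" "x \<notin> cbox p q"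
  shows "tensor f x = 0"
  using assms by (auto simp: tensor_def mem_box_cart)

lemma tensor_in_test_functions:
  assumes f: "\<And>i. f i \<in> interval_test_functions (p $ i) (q $ i)"
  shows "tensor f \<in> test_functions (box p q)"
proof -
  have "\<exists>l r. p $ i < l \<and> r < q $ i \<and> (\<forall>t. t \<notin> {l..r} \<longrightarrow> f i t = 0)" for i
    using f[of i] by (auto simp: interval_test_functions_def)
  then obtain l r where supp: "\<And>i. p $ i < l i" "\<And>i. r i < q $ i" "\<And>i t. t \<notin> {l i..r i} \<Longrightarrow> f i t = 0"
    by metis
  show ?thesis
  proof (rule test_functionsI[OF _ compact_cbox])
    show "C_infinity (tensor f)" by (intro C_infinity_tensor interval_test_functions_smooth[OF f])
    show "cbox (\<chi> i. l i) (\<chi> i. r i) \<subseteq> box p q"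
      using supp(1,2) unfolding subset_iff mem_box_cart vec_lambda_beta
      by (meson le_less_trans less_le_trans)
    show "tensor f x = 0" if "x \<notin> cbox (\<chi> i. l i) (\<chi> i. r i)" for x
      by (rule tensor_eq_0_outside_cbox[OF _ that]) (simp add: supp(3))
  qed
qed

definition bump_box :: "nat \<Rightarrow> real ^ 'n \<Rightarrow> real ^ 'n \<Rightarrow> real ^ 'n::finite \<Rightarrow> real" where
  "bump_box n p q = tensor (\<lambda>i. bump n (p $ i) (q $ i))"

lemma bump_box_eq_0: "x \<notin> box p q \<Longrightarrow> bump_box n p q x = 0"
  by (fastforce simp: bump_box_def tensor_def mem_box_cart intro: bump_eq_0)

lemma bump_box_nonneg: "0 \<le> bump_box n p q x" and bump_box_le_1: "bump_box n p q x \<le> 1"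
  by (auto simp: bump_box_def tensor_def bump_nonneg bump_le_1 intro: prod_nonneg prod_le_1)

lemma bump_box_tendsto_indicator: "(\<lambda>n. bump_box n p q x) \<longlonglongrightarrow> indicator (box p q) x"
proof -
  have "indicator (box p q) x = (\<Prod>i\<in>UNIV. indicator {p $ i<..<q $ i} (x $ i) :: real)"
    by (auto simp: indicator_def mem_box_cart)
  then show ?thesis
    by (simp add: bump_box_def tensor_def tendsto_prod bump_tendsto_indicator)
qed

lemma continuous_on_bump_box: "continuous_on S (bump_box n p q)"
  unfolding bump_box_def by (intro continuous_on_tensor smooth_bump)

lemma C_infinity_bump_box: "C_infinity (bump_box n p q)"
  unfolding bump_box_def by (intro C_infinity_tensor smooth_bump)

lemma bump_box_in_test_functions:
  assumes "cbox p q \<subseteq> \<Omega>"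
  shows "bump_box n p q \<in> test_functions \<Omega>"
proof (rule test_functionsI[OF C_infinity_bump_box compact_cbox assms])
  show "bump_box n p q x = 0" if "x \<notin> cbox p q" for x
    using that box_subset_cbox[of p q] by (intro bump_box_eq_0) blast
qed

subsection \<open>Lebesgue integrals over subsets\<close>

lemma borel_measurable_lebesgue_on_cong_AE:
  fixes f g :: "'a::euclidean_space \<Rightarrow> 'b::euclidean_space"
  assumes S: "S \<in> sets lebesgue" and f: "f \<in> borel_measurable (lebesgue_on S)"
    and eq: "AE x in lebesgue_on S. f x = g x"
  shows "g \<in> borel_measurable (lebesgue_on S)"
proof -
  have "AE x in lebesgue. (if x \<in> S then f x else 0) = (if x \<in> S then g x else 0)"
    using eq S by (simp add: AE_restrict_space_iff)
  with f show ?thesis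
    unfolding borel_measurable_if[OF S, symmetric] by (rule borel_measurable_AE)
qed

lemma integral_lebesgue_on_cong_AE:
  fixes f g :: "'a::euclidean_space \<Rightarrow> 'b::euclidean_space"
  assumes S: "S \<in> sets lebesgue" and eq: "AE x in lebesgue_on S. f x = g x"
  shows "(LINT x|lebesgue_on S. f x) = (LINT x|lebesgue_on S. g x)"
proof (cases "f \<in> borel_measurable (lebesgue_on S)")
  case True
  then show ?thesis
    using borel_measurable_lebesgue_on_cong_AE[OF S True eq] eq by (intro integral_cong_AE)
next
  case False
  then have "g \<notin> borel_measurable (lebesgue_on S)"
    using borel_measurable_lebesgue_on_cong_AE[OF S _ AE_symmetric[OF eq]] by blast
  with False show ?thesis
    by (metis borel_measurable_integrable not_integrable_integral_eq)
qed

lemma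
  fixes f :: "'a::euclidean_space \<Rightarrow> 'b::euclidean_space"
  assumes "K \<subseteq> S" "K \<in> sets lebesgue" "S \<in> sets lebesgue" "\<And>x. x \<notin> K \<Longrightarrow> f x = 0"
  shows integrable_lebesgue_on_support: "integrable (lebesgue_on S) f \<longleftrightarrow> integrable (lebesgue_on K) f"
    and integral_lebesgue_on_support: "(LINT x|lebesgue_on S. f x) = (LINT x|lebesgue_on K. f x)"
proof -
  have "(\<lambda>x. if x \<in> K then f x else 0) = f" "(\<lambda>x. if x \<in> S then f x else 0) = f"
    using assms(1,4) by (force simp: fun_eq_iff)+
  then show "integrable (lebesgue_on S) f \<longleftrightarrow> integrable (lebesgue_on K) f"
    "(LINT x|lebesgue_on S. f x) = (LINT x|lebesgue_on K. f x)"
    using Lebesgue_Measure.integrable_restrict_UNIV[OF assms(2), of f]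
      Lebesgue_Measure.integrable_restrict_UNIV[OF assms(3), of f]
      Lebesgue_Measure.integral_restrict[OF assms(1-3), of f] by simp_all
qed

lemma AE_lebesgue_on_subset:
  assumes "AE x in lebesgue_on S. P x" "T \<subseteq> S" "S \<in> sets lebesgue" "T \<in> sets lebesgue"
  shows "AE x in lebesgue_on T. P x"
  using assms by (auto simp: AE_restrict_space_iff)

lemma AE_lebesgue_on_cbox_if_box:
  assumes "AE x in lebesgue_on (box a b). P x"
  shows "AE x in lebesgue_on (cbox a b). P x"
proof -
  have "AE x in lebesgue. x \<in> box a b \<longrightarrow> P x"
    using assms by (simp add: AE_restrict_space_iff)
  moreover have "AE x in lebesgue. x \<notin> cbox a b - box a b"
    by (rule AE_not_in) (simp add: negligible_iff_null_sets[symmetric] negligible_frontier_interval)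
  ultimately have "AE x in lebesgue. x \<in> cbox a b \<longrightarrow> P x" by eventually_elim auto
  then show ?thesis by (simp add: AE_restrict_space_iff)
qed

lemma AE_lebesgue_on_open_if_boxes:
  assumes S: "open S" and boxes: "\<And>a b. cbox a b \<subseteq> S \<Longrightarrow> AE x in lebesgue_on (box a b). P x"
  shows "AE x in lebesgue_on S. P x"
proof -
  obtain D where cover: "countable D" "D \<subseteq> Pow S" "\<And>X. X \<in> D \<Longrightarrow> \<exists>a b. X = cbox a b" "\<Union>D = S"
    by (rule open_countable_Union_open_cbox[OF S]) (rule that; simp)
  have "AE x in lebesgue. x \<in> X \<longrightarrow> P x" if "X \<in> D" for X
  proof -
    obtain a b where X: "X = cbox a b" using cover(3)[OF \<open>X \<in> D\<close>] by blast
    with that cover(2) have "cbox a b \<subseteq> S" by blast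
    from AE_lebesgue_on_cbox_if_box[OF boxes[OF this]] show ?thesis
      unfolding X by (simp add: AE_restrict_space_iff)
  qed
  then have "AE x in lebesgue. \<forall>X\<in>D. x \<in> X \<longrightarrow> P x"
    by (subst AE_ball_countable[OF cover(1)]) blast
  then have "AE x in lebesgue. x \<in> S \<longrightarrow> P x"
    by eventually_elim (use cover(4) in auto)
  then show ?thesis using S by (simp add: AE_restrict_space_iff)
qed

subsection \<open>The fundamental lemma of the calculus of variations\<close>

lemma Int_stable_box: "Int_stable (range (\<lambda>(a, b). box a b :: 'a::euclidean_space set))"
proof (rule Int_stableI, clarify)
  fix a b a' b' :: 'a
  show "box a b \<inter> box a' b' \<in> range (\<lambda>(a, b). box a b)"
    unfolding box_Int_box by (rule range_eqI, rule case_prod_conv[symmetric])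
qed

lemma set_integrable_borel:
  fixes g :: "'a::euclidean_space \<Rightarrow> real"
  shows "integrable lebesgue g \<Longrightarrow> A \<in> sets borel \<Longrightarrow> set_integrable lebesgue A g"
  unfolding set_integrable_def by (rule integrable_mult_indicator) auto

lemma integral_eq_0_if_box_integrals_eq_0:
  fixes g :: "'a::euclidean_space \<Rightarrow> real"
  assumes g: "integrable lebesgue g" and boxes: "\<And>a b. (LINT x:box a b|lebesgue. g x) = 0"
  shows "(LINT x:UNIV|lebesgue. g x) = 0"
proof -
  have "(\<lambda>n. LINT x:box (- (real n *\<^sub>R One)) (real n *\<^sub>R One)|lebesgue. g x)
      \<longlonglongrightarrow> (LINT x:(\<Union>n::nat. box (- (real n *\<^sub>R One)) (real n *\<^sub>R One))|lebesgue. g x)"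
    by (rule set_integral_cont_up) (auto intro!: set_integrable_borel g simp: incseq_def box_def)
  then show ?thesis by (simp add: boxes UN_box_eq_UNIV LIMSEQ_const_iff)
qed

lemma borel_set_integral_eq_0_if_box_integrals_eq_0:
  fixes g :: "'a::euclidean_space \<Rightarrow> real"
  assumes g: "integrable lebesgue g" and boxes: "\<And>a b. (LINT x:box a b|lebesgue. g x) = 0"
    and "A \<in> sets borel"
  shows "(LINT x:A|lebesgue. g x) = 0"
proof -
  note int = set_integrable_borel[OF g]
  note Int_stable_box
  moreover have "range (\<lambda>(a, b). box a b :: 'a set) \<subseteq> Pow UNIV" by simp
  moreover from \<open>A \<in> sets borel\<close> have "A \<in> sigma_sets UNIV (range (\<lambda>(a, b). box a b :: 'a set))"
    by (simp add: borel_eq_box)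
  ultimately show ?thesis
  proof (induction A rule: sigma_sets_induct_disjoint)
    case (basic A)
    then show ?case using boxes by auto
  next
    case empty
    then show ?case by (simp add: set_lebesgue_integral_def)
  next
    case (compl A)
    then have "A \<in> sets borel" by (simp add: borel_eq_box)
    then have "(LINT x:A \<union> (UNIV - A)|lebesgue. g x) = (LINT x:A|lebesgue. g x) + (LINT x:UNIV - A|lebesgue. g x)"
      by (intro set_integral_Un int) auto
    then show ?case using compl integral_eq_0_if_box_integrals_eq_0[OF g boxes] by simp
  next
    case (union A)
    then have "A i \<in> sets borel" for i by (auto simp: borel_eq_box)
    then have "(LINT x:\<Union>i. A i|lebesgue. g x) = (\<Sum>i. LINT x:A i|lebesgue. g x)"
      using union.hyps by (intro lebesgue_integral_countable_add int) (auto simp: disjoint_family_on_def)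
    then show ?case using union by simp
  qed
qed

lemma AE_eq_0_if_box_integrals_eq_0:
  fixes g :: "'a::euclidean_space \<Rightarrow> real"
  assumes g: "integrable lebesgue g" and boxes: "\<And>a b. (LINT x:box a b|lebesgue. g x) = 0"
  shows "AE x in lebesgue. g x = 0"
proof (rule density_unique_real[OF g integrable_zero])
  fix A :: "'a set" assume "A \<in> sets lebesgue"
  then obtain S N N' where split: "A = S \<union> N" "N \<subseteq> N'" "N' \<in> null_sets lborel" "S \<in> sets borel"
    by (metis sets_completionE sets_lborel)
  have "AE x in lebesgue. x \<notin> N'" using split(3) by (intro AE_not_in null_sets_completionI)
  then have "AE x in lebesgue. indicator A x *\<^sub>R g x = indicator S x *\<^sub>R g x"
    by eventually_elim (use split(1,2) in \<open>auto simp: indicator_def\<close>)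
  then have "(LINT x:A|lebesgue. g x) = (LINT x:S|lebesgue. g x)"
    unfolding set_lebesgue_integral_def
    by (intro integral_lebesgue_on_cong_AE[of UNIV, unfolded lebesgue_on_UNIV_eq]) simp
  then show "(LINT x:A|lebesgue. g x) = (LINT x:A|lebesgue. 0)"
    using borel_set_integral_eq_0_if_box_integrals_eq_0[OF g boxes split(4)]
    by (simp add: set_lebesgue_integral_def)
qed

lemma locally_integrableD:
  "locally_integrable \<Omega> g \<Longrightarrow> compact K \<Longrightarrow> K \<subseteq> \<Omega> \<Longrightarrow> integrable (lebesgue_on K) g"
  by (intro absolutely_integrable_imp_integrable)
    (auto simp: locally_integrable_def lmeasurable_compact fmeasurableD)

lemma locally_integrable_subset: "locally_integrable \<Omega> g \<Longrightarrow> \<Omega>' \<subseteq> \<Omega> \<Longrightarrow> locally_integrable \<Omega>' g"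
  by (auto simp: locally_integrable_def)

lemma locally_integrable_const: "locally_integrable \<Omega> (\<lambda>x. c)"
  unfolding locally_integrable_def
  by (auto intro!: absolutely_integrable_on_const lmeasurable_compact)

lemma locally_integrable_linear:
  assumes "locally_integrable \<Omega> f" "locally_integrable \<Omega> g"
  shows "locally_integrable \<Omega> (\<lambda>x. a * f x + b * g x)"
  using assms unfolding locally_integrable_def by (auto intro!: set_integral_add set_integrable_mult_right)

lemma box_integral_eq_0_if_bump_box_integrals_eq_0:
  assumes g: "integrable (lebesgue_on (cbox p q)) g"
    and bumps: "\<And>n. (LINT x|lebesgue_on (cbox p q). g x * bump_box n p q x) = 0"
  shows "(LINT x|lebesgue_on (box p q). g x) = 0"
proof -
  have "(\<lambda>n. LINT x|lebesgue_on (cbox p q). g x * bump_box n p q x)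
      \<longlonglongrightarrow> (LINT x|lebesgue_on (cbox p q). g x * indicator (box p q) x)"
  proof (rule integral_dominated_convergence[where w="\<lambda>x. norm (g x)"])
    show "AE x in lebesgue_on (cbox p q). (\<lambda>n. g x * bump_box n p q x) \<longlonglongrightarrow> g x * indicator (box p q) x"
      by (intro AE_I2 tendsto_mult tendsto_const bump_box_tendsto_indicator)
    show "(\<lambda>x. g x * bump_box n p q x) \<in> borel_measurable (lebesgue_on (cbox p q))" for n
      by (intro borel_measurable_times borel_measurable_integrable[OF g]
          continuous_imp_measurable_on_sets_lebesgue continuous_on_bump_box) auto
    show "(\<lambda>x. g x * indicator (box p q) x) \<in> borel_measurable (lebesgue_on (cbox p q))"
      by (intro borel_measurable_times borel_measurable_integrable[OF g] borel_measurable_indicator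
          sets_restrict_space_iff[THEN iffD2]) (auto simp: box_subset_cbox)
    show "AE x in lebesgue_on (cbox p q). norm (g x * bump_box n p q x) \<le> norm (g x)" for n
      by (intro AE_I2) (simp add: abs_mult bump_box_nonneg bump_box_le_1 mult_left_le)
  qed (use g in auto)
  then have "(LINT x|lebesgue_on (cbox p q). g x * indicator (box p q) x) = 0"
    by (simp add: bumps LIMSEQ_const_iff)
  also have "(\<lambda>x. g x * indicator (box p q) x) = (\<lambda>x. if x \<in> box p q then g x else 0)"
    by (auto simp: indicator_def)
  finally show ?thesis by (simp add: Lebesgue_Measure.integral_restrict box_subset_cbox)
qed

lemma AE_eq_0_if_bump_box_integrals_eq_0:
  assumes "open \<Omega>" and g: "locally_integrable \<Omega> g"
    and bumps: "\<And>n p q. cbox p q \<subseteq> \<Omega> \<Longrightarrow> (LINT x|lebesgue_on \<Omega>. g x * bump_box n p q x) = 0"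
  shows "AE x in lebesgue_on \<Omega>. g x = 0"
proof (rule AE_lebesgue_on_open_if_boxes[OF \<open>open \<Omega>\<close>])
  have box_integral: "(LINT x|lebesgue_on (box p q). g x) = 0" if sub: "cbox p q \<subseteq> \<Omega>" for p q
  proof (rule box_integral_eq_0_if_bump_box_integrals_eq_0)
    show "integrable (lebesgue_on (cbox p q)) g" by (rule locally_integrableD[OF g compact_cbox sub])
    have "(LINT x|lebesgue_on \<Omega>. g x * bump_box n p q x)
        = (LINT x|lebesgue_on (cbox p q). g x * bump_box n p q x)" for n
      using sub \<open>open \<Omega>\<close> box_subset_cbox[of p q] bump_box_eq_0[of _ p q]
      by (intro integral_lebesgue_on_support) auto
    then show "(LINT x|lebesgue_on (cbox p q). g x * bump_box n p q x) = 0" for n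
      using bumps[OF sub] by simp
  qed
  fix p q assume sub: "cbox p q \<subseteq> \<Omega>"
  let ?g = "\<lambda>x. if x \<in> box p q then g x else 0"
  have "AE x in lebesgue. ?g x = 0"
  proof (rule AE_eq_0_if_box_integrals_eq_0)
    have "set_integrable lebesgue (cbox p q) g"
      using g sub by (simp add: locally_integrable_def)
    then have "set_integrable lebesgue (box p q) g"
      by (rule set_integrable_subset) (auto simp: box_subset_cbox)
    then show "integrable lebesgue ?g"
      by (simp add: set_integrable_def indicator_scaleR_eq_if del: real_scaleR_def)
    fix a b
    obtain p' q' where box: "box a b \<inter> box p q = box p' q'" and "cbox a b \<inter> cbox p q = cbox p' q'"
      unfolding box_Int_box Int_interval by blast
    then have "cbox p' q' \<subseteq> \<Omega>" using sub by blast
    have "(LINT x:box a b|lebesgue. ?g x) = (LINT x|lebesgue_on (box p q \<inter> box a b). g x)"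
      unfolding set_lebesgue_integral_def
      by (subst integral_restrict_space)
        (auto simp: indicator_def intro!: Bochner_Integration.integral_cong)
    also have "\<dots> = 0" using box_integral[OF \<open>cbox p' q' \<subseteq> \<Omega>\<close>] box by (simp add: Int_commute)
    finally show "(LINT x:box a b|lebesgue. ?g x) = 0" .
  qed
  then show "AE x in lebesgue_on (box p q). g x = 0"
    by (simp add: AE_restrict_space_iff if_split_eq1 imp_conv_disj disj_commute)
qed

subsection \<open>Integration by parts against test functions\<close>

lemma integrable_locally_integrable_times_test_function:
  assumes \<Omega>: "\<Omega> \<in> sets lebesgue" and f: "locally_integrable \<Omega> f" and \<phi>: "\<phi> \<in> test_functions \<Omega>"
  shows "integrable (lebesgue_on \<Omega>) (\<lambda>x. f x * \<phi> x)"
proof -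
  obtain K where K: "compact K" "K \<subseteq> \<Omega>" "\<And>x. x \<notin> K \<Longrightarrow> \<phi> x = 0"
    using \<phi> test_functionsE by metis
  have K_sets: "K \<in> sets lebesgue" using K(1) by (simp add: lmeasurable_compact fmeasurableD)
  have cont: "continuous_on K \<phi>" using \<phi> by (intro C_infinity_continuous_on test_functions_C_infinity)
  have "(\<lambda>x. \<phi> x * f x) absolutely_integrable_on K"
  proof (rule absolutely_integrable_bounded_measurable_product[OF bilinear_times _ K_sets])
    show "\<phi> \<in> borel_measurable (lebesgue_on K)"
      by (rule continuous_imp_measurable_on_sets_lebesgue[OF cont K_sets])
    show "bounded (\<phi> ` K)"
      by (intro compact_imp_bounded compact_continuous_image cont K(1))
    show "f absolutely_integrable_on K" using f K by (simp add: locally_integrable_def)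
  qed
  then have "integrable (lebesgue_on K) (\<lambda>x. f x * \<phi> x)"
    using absolutely_integrable_imp_integrable[OF _ K_sets] by (simp add: mult.commute)
  then show ?thesis
    using integrable_lebesgue_on_support[OF K(2) K_sets \<Omega>, of "\<lambda>x. f x * \<phi> x"] K(3) by simp
qed

lemma integrable_test_function:
  "\<Omega> \<in> sets lebesgue \<Longrightarrow> \<phi> \<in> test_functions \<Omega> \<Longrightarrow> integrable (lebesgue_on \<Omega>) \<phi>"
  using integrable_locally_integrable_times_test_function[OF _ locally_integrable_const, of \<Omega> \<phi> 1] by simp

lemma integral_cbox_translate:
  fixes f :: "real ^ 'n \<Rightarrow> 'b::euclidean_space"
  assumes supp: "\<And>x. x \<notin> cbox p q \<Longrightarrow> f x = 0" and h: "\<And>i. \<bar>h $ i\<bar> \<le> 1"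
  shows "integral (cbox (p - 1) (q + 1)) (\<lambda>x. f (x + h)) = integral UNIV f"
proof -
  let ?B = "cbox (p - 1 + h) (q + 1 + h)"
  have "x \<in> ?B" if "x \<in> cbox p q" for x
    unfolding mem_box_cart
  proof
    fix i
    have "p $ i \<le> x $ i" "x $ i \<le> q $ i" using that by (auto simp: mem_box_cart)
    with h[of i] show "(p - 1 + h) $ i \<le> x $ i \<and> x $ i \<le> (q + 1 + h) $ i"
      unfolding vector_add_component vector_minus_component one_index by linarith
  qed
  then have extend: "(\<lambda>x. if x \<in> ?B then f x else 0) = f"
    using supp by (intro ext) (auto dest: spec)
  have "integral (cbox (p - 1) (q + 1)) (\<lambda>x. f (x + h)) = integral ?B f"
    using integral_shift_cbox[of "p - 1 + h" h "q + 1 + h" f] by simp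
  also have "\<dots> = integral UNIV f"
    using Henstock_Kurzweil_Integration.integral_restrict_UNIV[of ?B f] unfolding extend by simp
  finally show ?thesis .
qed

text \<open>Near \<open>t = 0\<close> the integral of \<open>\<phi>(x + t e\<^sub>i)\<close> over the enlarged box does not depend on \<open>t\<close>.\<close>

lemma integral_cbox_pd_eq_0:
  assumes \<phi>: "C_k 1 \<phi>" and supp: "\<And>x. x \<notin> cbox p q \<Longrightarrow> \<phi> x = 0"
  shows "integral (cbox (p - 1) (q + 1)) (pd i \<phi>) = 0"
proof -
  let ?e = "axis i 1 :: heis" and ?B = "cbox (p - 1) (q + 1)"
  have diff: "\<phi> differentiable_on UNIV" and cont_pd: "continuous_on UNIV (pd i \<phi>)"
    using \<phi> by simp_all
  define G where "G t = integral ?B (\<lambda>x. \<phi> (x + t *\<^sub>R ?e))" for t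
  have "G t = integral UNIV \<phi>" if "\<bar>t\<bar> < 1" for t
    unfolding G_def by (rule integral_cbox_translate[OF supp]) (use that in \<open>auto simp: axis_def\<close>)
  then have "(G has_real_derivative 0) (at 0)"
    by (intro has_field_derivative_transform_within_open[OF DERIV_const, of "{-1<..<1}"]) auto
  moreover have "(G has_real_derivative integral ?B (\<lambda>x. pd i \<phi> (x + 0 *\<^sub>R ?e))) (at 0)"
    unfolding G_def
  proof (rule leibniz_rule_field_derivative[where U=UNIV])
    show "((\<lambda>t. \<phi> (x + t *\<^sub>R ?e)) has_real_derivative pd i \<phi> (x + t *\<^sub>R ?e)) (at t within UNIV)" for t x
      by (simp add: pd_DERIV[OF diff])
    show "(\<lambda>x. \<phi> (x + t *\<^sub>R ?e)) integrable_on ?B" for t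
      by (intro integrable_continuous continuous_on_compose2[OF differentiable_imp_continuous_on[OF diff]])
        (auto intro!: continuous_intros)
    show "continuous_on (UNIV \<times> ?B) (\<lambda>(t, x). pd i \<phi> (x + t *\<^sub>R ?e))"
      unfolding case_prod_unfold
      by (intro continuous_on_compose2[OF cont_pd]) (auto intro!: continuous_intros)
  qed auto
  ultimately show ?thesis using DERIV_unique by fastforce
qed

lemma integral_pd_eq_0:
  assumes \<Omega>: "\<Omega> \<in> sets lebesgue" and \<phi>: "\<phi> \<in> test_functions \<Omega>"
  shows "(LINT x|lebesgue_on \<Omega>. pd i \<phi> x) = 0"
proof -
  obtain K where K: "compact K" "K \<subseteq> \<Omega>" "\<And>x. x \<notin> K \<Longrightarrow> \<phi> x = 0"
    using \<phi> test_functionsE by metis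
  have K_sets: "K \<in> sets lebesgue" using K(1) by (simp add: lmeasurable_compact fmeasurableD)
  have pd_0: "pd i \<phi> x = 0" if "x \<notin> K" for x
    by (rule pd_eq_0_outside_support[OF compact_imp_closed[OF K(1)] K(3) that])
  obtain p q where "K \<subseteq> cbox p q"
    using bounded_subset_cbox_symmetric[OF compact_imp_bounded[OF K(1)]] by blast
  moreover have "cbox p q \<subseteq> cbox (p - 1) (q + 1)"
    by (simp add: subset_iff mem_box_cart diff_le_eq add_increasing2)
  ultimately have sub: "K \<subseteq> cbox (p - 1) (q + 1)" by blast
  have "(LINT x|lebesgue_on \<Omega>. pd i \<phi> x) = (LINT x|lebesgue_on K. pd i \<phi> x)"
    by (rule integral_lebesgue_on_support[OF K(2) K_sets \<Omega> pd_0])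
  also have "\<dots> = (LINT x|lebesgue_on (cbox (p - 1) (q + 1)). pd i \<phi> x)"
    by (rule integral_lebesgue_on_support[OF sub K_sets _ pd_0, symmetric]) auto
  also have "\<dots> = integral (cbox (p - 1) (q + 1)) (pd i \<phi>)"
    using test_functions_C_infinity[OF \<phi>]
    by (intro lebesgue_integral_eq_integral continuous_imp_integrable C_infinity_continuous_on C_infinity_pd) auto
  also have "\<dots> = 0"
    using \<open>K \<subseteq> cbox p q\<close> K(3) test_functions_C_infinity[OF \<phi>]
    by (intro integral_cbox_pd_eq_0) (auto simp: C_infinity_def simp del: C_k.simps)
  finally show ?thesis .
qed

lemma integral_hX_eq_0:
  assumes \<Omega>: "\<Omega> \<in> sets lebesgue" and \<phi>: "\<phi> \<in> test_functions \<Omega>"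
  shows "(LINT x|lebesgue_on \<Omega>. hX i \<phi> x) = 0"
proof -
  note zero = integral_pd_eq_0[OF \<Omega>] and int = integrable_test_function[OF \<Omega> pd_in_test_functions]
  show ?thesis using exhaust_2[of i]
    by (auto simp: hX_divergence_form[OF test_functions_C_infinity[OF \<phi>]] zero int \<phi> nth_mult_in_test_functions)
qed

subsection \<open>Weak horizontal derivatives\<close>

lemma is_weak_X_linear:
  assumes \<Omega>: "\<Omega> \<in> sets lebesgue" and f: "is_weak_X i \<Omega> f f'" and g: "is_weak_X i \<Omega> g g'"
  shows "is_weak_X i \<Omega> (\<lambda>x. a * f x + b * g x) (\<lambda>x. a * f' x + b * g' x)"
  unfolding is_weak_X_def
proof (intro conjI ballI)
  have loc: "locally_integrable \<Omega> f" "locally_integrable \<Omega> f'" "locally_integrable \<Omega> g" "locally_integrable \<Omega> g'"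
    using f g by (auto simp: is_weak_X_def)
  then show "locally_integrable \<Omega> (\<lambda>x. a * f x + b * g x)" "locally_integrable \<Omega> (\<lambda>x. a * f' x + b * g' x)"
    by (auto intro: locally_integrable_linear)
  fix \<phi> assume \<phi>: "\<phi> \<in> test_functions \<Omega>"
  have lin: "(LINT x|lebesgue_on \<Omega>. (a * v x + b * w x) * \<psi> x)
      = a * (LINT x|lebesgue_on \<Omega>. v x * \<psi> x) + b * (LINT x|lebesgue_on \<Omega>. w x * \<psi> x)"
    if "locally_integrable \<Omega> v" "locally_integrable \<Omega> w" "\<psi> \<in> test_functions \<Omega>" for v w \<psi>
    using that by (simp add: distrib_right mult.assoc integrable_locally_integrable_times_test_function[OF \<Omega>])
  show "(LINT x|lebesgue_on \<Omega>. (a * f x + b * g x) * hX i \<phi> x)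
      = - (LINT x|lebesgue_on \<Omega>. (a * f' x + b * g' x) * \<phi> x)"
    using f g \<phi> by (simp add: lin loc hX_in_test_functions is_weak_X_def)
qed

lemma is_weak_X_const: "\<Omega> \<in> sets lebesgue \<Longrightarrow> is_weak_X i \<Omega> (\<lambda>x. c) (\<lambda>x. 0)"
  by (simp add: is_weak_X_def locally_integrable_const integral_hX_eq_0)

lemma is_weak_X_subset:
  assumes "is_weak_X i \<Omega> f g" "\<Omega>' \<subseteq> \<Omega>" "\<Omega>' \<in> sets lebesgue" "\<Omega> \<in> sets lebesgue"
  shows "is_weak_X i \<Omega>' f g"
  unfolding is_weak_X_def
proof (intro conjI ballI)
  show "locally_integrable \<Omega>' f" "locally_integrable \<Omega>' g"
    using assms(1,2) by (auto simp: is_weak_X_def intro: locally_integrable_subset)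
  fix \<phi> assume \<phi>: "\<phi> \<in> test_functions \<Omega>'"
  have restrict: "(LINT x|lebesgue_on \<Omega>. v x * \<psi> x) = (LINT x|lebesgue_on \<Omega>'. v x * \<psi> x)"
    if \<psi>: "\<psi> \<in> test_functions \<Omega>'" for v \<psi>
  proof -
    obtain K where "K \<subseteq> \<Omega>'" "\<And>x. x \<notin> K \<Longrightarrow> \<psi> x = 0" using \<psi> test_functionsE by metis
    then show ?thesis by (intro integral_lebesgue_on_support assms(2-4)) auto
  qed
  have "\<phi> \<in> test_functions \<Omega>" using \<phi> test_functions_mono[OF assms(2)] by blast
  then show "(LINT x|lebesgue_on \<Omega>'. f x * hX i \<phi> x) = - (LINT x|lebesgue_on \<Omega>'. g x * \<phi> x)"
    using assms(1) \<phi> by (simp add: is_weak_X_def hX_in_test_functions flip: restrict)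
qed

lemma locally_integrable_cong_AE:
  assumes f: "locally_integrable \<Omega> f" and \<Omega>: "\<Omega> \<in> sets lebesgue" and eq: "AE x in lebesgue_on \<Omega>. f x = g x"
  shows "locally_integrable \<Omega> g"
  unfolding locally_integrable_def
proof (intro allI impI, elim conjE)
  fix K assume K: "compact K" "K \<subseteq> \<Omega>"
  have int: "integrable lebesgue (\<lambda>x. indicator K x *\<^sub>R f x)"
    using f K by (simp add: locally_integrable_def set_integrable_def)
  have eq_K: "AE x in lebesgue. indicator K x *\<^sub>R f x = indicator K x *\<^sub>R g x"
    using eq \<Omega> K(2) by (auto simp: AE_restrict_space_iff indicator_def elim!: eventually_mono)
  show "g absolutely_integrable_on K"
    unfolding set_integrable_def
    by (rule integrable_cong_AE_imp[OF int borel_measurable_AE[OF borel_measurable_integrable[OF int] eq_K] eq_K])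
qed

lemma is_weak_X_cong_AE:
  assumes f: "is_weak_X i \<Omega> f g" and \<Omega>: "\<Omega> \<in> sets lebesgue" and eq: "AE x in lebesgue_on \<Omega>. g x = g' x"
  shows "is_weak_X i \<Omega> f g'"
proof -
  have "(LINT x|lebesgue_on \<Omega>. g x * \<phi> x) = (LINT x|lebesgue_on \<Omega>. g' x * \<phi> x)" for \<phi>
    by (rule integral_lebesgue_on_cong_AE[OF \<Omega>]) (use eq in \<open>eventually_elim, simp\<close>)
  then show ?thesis
    using f locally_integrable_cong_AE[OF _ \<Omega> eq] by (simp add: is_weak_X_def)
qed

lemma is_weak_X_unique:
  assumes "open \<Omega>" and g: "is_weak_X i \<Omega> f g" and g': "is_weak_X i \<Omega> f g'"
  shows "AE x in lebesgue_on \<Omega>. g x = g' x"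
proof -
  have \<Omega>: "\<Omega> \<in> sets lebesgue" using \<open>open \<Omega>\<close> by simp
  have "is_weak_X i \<Omega> (\<lambda>x. 0) (\<lambda>x. g x - g' x)"
    using is_weak_X_linear[OF \<Omega> g g', of 1 "-1"] by simp
  then have "AE x in lebesgue_on \<Omega>. g x - g' x = 0"
    by (intro AE_eq_0_if_bump_box_integrals_eq_0[OF \<open>open \<Omega>\<close>])
      (simp_all add: is_weak_X_def bump_box_in_test_functions)
  then show ?thesis by simp
qed

lemma is_weak_X_wX: "is_weak_X i \<Omega> f g \<Longrightarrow> is_weak_X i \<Omega> f (wX i \<Omega> f)"
  unfolding wX_def by (rule someI[where P="is_weak_X i \<Omega> f"])

lemma wX_eq_AE: "open \<Omega> \<Longrightarrow> is_weak_X i \<Omega> f g \<Longrightarrow> AE x in lebesgue_on \<Omega>. wX i \<Omega> f x = g x"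
  using is_weak_X_unique is_weak_X_wX by blast

definition weakly_X_differentiable :: "heis set \<Rightarrow> (heis \<Rightarrow> real) \<Rightarrow> bool" where
  "weakly_X_differentiable \<Omega> f \<longleftrightarrow> (\<forall>i. is_weak_X i \<Omega> f (wX i \<Omega> f))"

lemma weakly_X_differentiableI: "(\<And>i. \<exists>g. is_weak_X i \<Omega> f g) \<Longrightarrow> weakly_X_differentiable \<Omega> f"
  unfolding weakly_X_differentiable_def using is_weak_X_wX by blast

lemma hgrad_linear_AE:
  assumes "open \<Omega>" "weakly_X_differentiable \<Omega> f" "weakly_X_differentiable \<Omega> g"
  shows "AE x in lebesgue_on \<Omega>.
    hgrad \<Omega> (\<lambda>x. a * f x + b * g x) x = a *\<^sub>R hgrad \<Omega> f x + b *\<^sub>R hgrad \<Omega> g x"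
proof -
  have "AE x in lebesgue_on \<Omega>. \<forall>i. wX i \<Omega> (\<lambda>x. a * f x + b * g x) x = a * wX i \<Omega> f x + b * wX i \<Omega> g x"
    using assms by (intro eventually_all_finite wX_eq_AE is_weak_X_linear) (auto simp: weakly_X_differentiable_def)
  then show ?thesis by eventually_elim (simp add: vec_eq_iff hgrad_def)
qed

lemma hgrad_const_AE:
  assumes "open \<Omega>" shows "AE x in lebesgue_on \<Omega>. hgrad \<Omega> (\<lambda>x. c) x = 0"
proof -
  have "AE x in lebesgue_on \<Omega>. \<forall>i. wX i \<Omega> (\<lambda>x. c) x = 0"
    using assms by (intro eventually_all_finite wX_eq_AE is_weak_X_const) auto
  then show ?thesis by eventually_elim (simp add: vec_eq_iff hgrad_def)
qed

subsection \<open>Functions with vanishing horizontal gradient\<close>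

lemma integral_mult_pd_eq_0:
  assumes \<Omega>: "\<Omega> \<in> sets lebesgue" and weak: "\<And>i. is_weak_X i \<Omega> h (\<lambda>x. 0)" and \<phi>: "\<phi> \<in> test_functions \<Omega>"
  shows "(LINT x|lebesgue_on \<Omega>. h x * pd i \<phi> x) = 0"
proof -
  have integral_hX: "(LINT x|lebesgue_on \<Omega>. h x * hX i \<psi> x) = 0" if "\<psi> \<in> test_functions \<Omega>" for i \<psi>
    using weak[of i] that by (simp add: is_weak_X_def)
  have int: "integrable (lebesgue_on \<Omega>) (\<lambda>x. h x * \<psi> x)" if "\<psi> \<in> test_functions \<Omega>" for \<psi>
    using weak[of 1] that
    by (intro integrable_locally_integrable_times_test_function[OF \<Omega>]) (auto simp: is_weak_X_def)
  have integral_pd_3: "(LINT x|lebesgue_on \<Omega>. h x * pd 3 \<psi> x) = 0" if \<psi>: "\<psi> \<in> test_functions \<Omega>" for \<psi>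
  proof -
    have "(LINT x|lebesgue_on \<Omega>. h x * hX 1 (hX 2 \<psi>) x - h x * hX 2 (hX 1 \<psi>) x) = 0"
      using \<psi> by (subst Bochner_Integration.integral_diff) (auto simp: integral_hX int hX_in_test_functions)
    moreover have "h x * hX 1 (hX 2 \<psi>) x - h x * hX 2 (hX 1 \<psi>) x = - 4 * (h x * pd 3 \<psi> x)" for x
      using hX_commutator[OF test_functions_C_infinity[OF \<psi>], of x] by (simp flip: right_diff_distrib)
    ultimately show ?thesis by simp
  qed
  note divergence_form = hX_divergence_form[OF test_functions_C_infinity[OF \<phi>]]
  note [simp] = integral_hX[OF \<phi>] integral_pd_3 int hX_in_test_functions[OF \<phi>]
    nth_mult_in_test_functions[OF \<phi>] pd_in_test_functions
  consider (X1) "i = 1" | (X2) "i = 2" | (vertical) "i = 3" using exhaust_3[of i] by blast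
  then show ?thesis
  proof cases
    case X1
    have "(LINT x|lebesgue_on \<Omega>. h x * pd 1 \<phi> x)
        = (LINT x|lebesgue_on \<Omega>. h x * hX 1 \<phi> x - 2 * (h x * pd 3 (\<lambda>x. x $ 2 * \<phi> x) x))"
      by (simp add: divergence_form algebra_simps)
    then show ?thesis using X1 by simp
  next
    case X2
    have "(LINT x|lebesgue_on \<Omega>. h x * pd 2 \<phi> x)
        = (LINT x|lebesgue_on \<Omega>. h x * hX 2 \<phi> x + 2 * (h x * pd 3 (\<lambda>x. x $ 1 * \<phi> x) x))"
      by (simp add: divergence_form algebra_simps)
    then show ?thesis using X2 by simp
  qed (simp add: \<phi>)
qed

lemma integral_mult_tensor_fun_upd:
  assumes h: "locally_integrable (box p q) h"
    and pd_0: "\<And>\<phi>. \<phi> \<in> test_functions (box p q) \<Longrightarrow> (LINT x|lebesgue_on (box p q). h x * pd j \<phi> x) = 0"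
    and ne: "p $ j < q $ j"
    and g: "\<And>i. g i \<in> interval_test_functions (p $ i) (q $ i)"
    and e: "e \<in> interval_test_functions (p $ j) (q $ j)" "integral {p $ j..q $ j} e = 1"
    and f: "f \<in> interval_test_functions (p $ j) (q $ j)"
  shows "(LINT x|lebesgue_on (box p q). h x * tensor (g(j := f)) x)
    = integral {p $ j..q $ j} f * (LINT x|lebesgue_on (box p q). h x * tensor (g(j := e)) x)"
proof (rule linear_functional_proportional_to_integral[OF _ _ ne e f])
  fix a assume a: "a \<in> interval_test_functions (p $ j) (q $ j)"
  then have test: "tensor (g(j := a)) \<in> test_functions (box p q)"
    using g by (intro tensor_in_test_functions) auto
  have "smooth ((g(j := a)) i)" for i
    using g a interval_test_functions_smooth by (cases "i = j") auto
  from pd_tensor[of "g(j := a)", OF this, of j]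
  show "(LINT x|lebesgue_on (box p q). h x * tensor (g(j := deriv a)) x) = 0"
    using pd_0[OF test] by simp
next
  fix a b r s
  assume ab: "a \<in> interval_test_functions (p $ j) (q $ j)" "b \<in> interval_test_functions (p $ j) (q $ j)"
  have int: "integrable (lebesgue_on (box p q)) (\<lambda>x. h x * tensor (g(j := c)) x)"
    if "c \<in> interval_test_functions (p $ j) (q $ j)" for c
    using g that
    by (intro integrable_locally_integrable_times_test_function[OF _ h] tensor_in_test_functions) auto
  have "h x * tensor (g(j := \<lambda>t. r * a t + s * b t)) x
      = r * (h x * tensor (g(j := a)) x) + s * (h x * tensor (g(j := b)) x)" for x
    by (simp add: tensor_fun_upd algebra_simps)
  then show "(LINT x|lebesgue_on (box p q). h x * tensor (g(j := \<lambda>t. r * a t + s * b t)) x)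
      = r * (LINT x|lebesgue_on (box p q). h x * tensor (g(j := a)) x)
        + s * (LINT x|lebesgue_on (box p q). h x * tensor (g(j := b)) x)"
    using int ab by simp
qed

lemma integral_mult_tensor_proportional:
  assumes h: "locally_integrable (box p q) h"
    and pd_0: "\<And>i \<phi>. \<phi> \<in> test_functions (box p q) \<Longrightarrow> (LINT x|lebesgue_on (box p q). h x * pd i \<phi> x) = 0"
    and ne: "\<And>i. p $ i < q $ i"
    and e: "\<And>i. e i \<in> interval_test_functions (p $ i) (q $ i)" "\<And>i. integral {p $ i..q $ i} (e i) = 1"
    and f: "\<And>i. f i \<in> interval_test_functions (p $ i) (q $ i)"
  shows "(LINT x|lebesgue_on (box p q). h x * tensor f x)
    = (\<Prod>i\<in>UNIV. integral {p $ i..q $ i} (f i)) * (LINT x|lebesgue_on (box p q). h x * tensor e x)"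
proof -
  define L where "L g = (LINT x|lebesgue_on (box p q). h x * tensor g x)" for g
  have "L (\<lambda>i. if i \<in> I then f i else e i) = (\<Prod>i\<in>I. integral {p $ i..q $ i} (f i)) * L e" for I
    using finite[of I]
  proof (induction I rule: finite_induct)
    case (insert j I)
    let ?g = "\<lambda>i. if i \<in> I then f i else e i"
    have "L (?g(j := f j)) = integral {p $ j..q $ j} (f j) * L (?g(j := e j))"
      unfolding L_def by (rule integral_mult_tensor_fun_upd[OF h pd_0 ne _ e f]) (simp_all add: e f)
    moreover have "(\<lambda>i. if i \<in> insert j I then f i else e i) = ?g(j := f j)" "?g(j := e j) = ?g"
      using insert.hyps(2) by auto
    ultimately show ?case using insert by simp
  qed simp
  from this[of UNIV] show ?thesis by (simp add: L_def)
qed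

lemma AE_eq_0_on_box_if_weak_X_zero:
  assumes weak: "\<And>i. is_weak_X i (box p q) h (\<lambda>x. 0)"
    and ne: "\<And>i. p $ i < q $ i"
    and e: "\<And>i. e i \<in> interval_test_functions (p $ i) (q $ i)" "\<And>i. integral {p $ i..q $ i} (e i) = 1"
    and h_e: "(LINT x|lebesgue_on (box p q). h x * tensor e x) = 0"
  shows "AE x in lebesgue_on (box p q). h x = 0"
proof (rule AE_eq_0_if_bump_box_integrals_eq_0)
  show loc: "locally_integrable (box p q) h" using weak[of 1] by (simp add: is_weak_X_def)
  fix n a b assume sub: "cbox a b \<subseteq> box p q"
  show "(LINT x|lebesgue_on (box p q). h x * bump_box n a b x) = 0"
  proof (cases "cbox a b = {}")
    case True
    then have "bump_box n a b x = 0" for x using bump_box_eq_0 box_subset_cbox by blast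
    then show ?thesis by simp
  next
    case False
    then have "a \<in> box p q" "b \<in> box p q"
      using sub by (auto simp: interval_ne_empty_cart mem_box_cart subset_iff)
    then have "bump n (a $ i) (b $ i) \<in> interval_test_functions (p $ i) (q $ i)" for i
      by (intro bump_in_interval_test_functions) (auto simp: mem_box_cart)
    from integral_mult_tensor_proportional[OF loc integral_mult_pd_eq_0[OF _ weak] ne e this]
    show ?thesis by (simp add: bump_box_def h_e)
  qed
qed (rule open_box)

lemma AE_const_on_box_if_weak_X_zero:
  assumes weak: "\<And>i. is_weak_X i (box p q) h (\<lambda>x. 0)"
  shows "\<exists>c. AE x in lebesgue_on (box p q). h x = c"
proof (cases "box p q = {}")
  case False
  then have ne: "p $ i < q $ i" for i by (auto simp: interval_ne_empty_cart)
  let ?M = "lebesgue_on (box p q)"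
  have "\<exists>e. e \<in> interval_test_functions (p $ i) (q $ i) \<and> integral {p $ i..q $ i} e = 1" for i
    using interval_test_function_integral_1[OF ne[of i]] by metis
  then obtain e where e: "\<And>i. e i \<in> interval_test_functions (p $ i) (q $ i)"
    "\<And>i. integral {p $ i..q $ i} (e i) = 1"
    by metis
  note zero = AE_eq_0_on_box_if_weak_X_zero[OF _ ne e]
  have e_int: "(LINT x|?M. tensor e x) \<noteq> 0"
  proof
    assume "(LINT x|?M. tensor e x) = 0"
    then have "AE x in ?M. (1::real) = 0" by (intro zero is_weak_X_const) auto
    then have "negligible (box p q)"
      by (simp add: AE_restrict_space_iff negligible_iff_null_sets AE_iff_null_sets)
    then show False using False by (simp add: negligible_interval)
  qed
  define c where "c = (LINT x|?M. h x * tensor e x) / (LINT x|?M. tensor e x)"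
  have "AE x in ?M. 1 * h x + (- c) * 1 = 0"
  proof (rule zero)
    show "is_weak_X i (box p q) (\<lambda>x. 1 * h x + (- c) * 1) (\<lambda>x. 0)" for i
      using is_weak_X_linear[OF _ weak is_weak_X_const, of i 1 "- c" 1] by simp
    have "tensor e \<in> test_functions (box p q)" by (rule tensor_in_test_functions[OF e(1)])
    then have "integrable ?M (\<lambda>x. h x * tensor e x)" "integrable ?M (tensor e)"
      using weak[of 1] by (auto simp: is_weak_X_def
          intro: integrable_locally_integrable_times_test_function integrable_test_function)
    then show "(LINT x|?M. (1 * h x + (- c) * 1) * tensor e x) = 0"
      using e_int by (simp add: c_def left_diff_distrib)
  qed
  then show ?thesis by auto
qed (simp add: AE_restrict_space_iff)

subsection \<open>Square-integrable vector-valued functions\<close>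

definition square_integrable :: "'a measure \<Rightarrow> ('a \<Rightarrow> 'b::real_normed_vector) \<Rightarrow> bool" where
  "square_integrable M v \<longleftrightarrow> v \<in> borel_measurable M \<and> integrable M (\<lambda>x. (norm (v x))\<^sup>2)"

definition L2_norm :: "'a measure \<Rightarrow> ('a \<Rightarrow> 'b::real_normed_vector) \<Rightarrow> real" where
  "L2_norm M v = sqrt (LINT x|M. (norm (v x))\<^sup>2)"

lemma square_integrable_measurable: "square_integrable M v \<Longrightarrow> v \<in> borel_measurable M"
  and square_integrable_integrable: "square_integrable M v \<Longrightarrow> integrable M (\<lambda>x. (norm (v x))\<^sup>2)"
  by (simp_all add: square_integrable_def)

lemma L2_iff_square_integrable: "f \<in> L2 S \<longleftrightarrow> square_integrable (lebesgue_on S) f"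
  by (simp add: L2_def square_integrable_def)

lemma L2_norm_nonneg: "0 \<le> L2_norm M v"
  by (simp add: L2_norm_def)

lemma L2_norm_power2: "(L2_norm M v)\<^sup>2 = (LINT x|M. (norm (v x))\<^sup>2)"
  by (simp add: L2_norm_def)

lemma square_integrable_bound:
  assumes "square_integrable M v" "w \<in> borel_measurable M" "AE x in M. norm (w x) \<le> norm (v x)"
  shows "square_integrable M w"
  unfolding square_integrable_def
proof (intro conjI Bochner_Integration.integrable_bound[OF square_integrable_integrable[OF assms(1)]])
  show "AE x in M. norm ((norm (w x))\<^sup>2) \<le> norm ((norm (v x))\<^sup>2)"
    using assms(3) by eventually_elim simp
qed (use assms(2) in measurable)

lemma (in finite_measure) square_integrable_const: "square_integrable M (\<lambda>x. c)"
  by (simp add: square_integrable_def)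

lemma square_integrable_add:
  fixes v w :: "'a \<Rightarrow> 'b::{real_normed_vector, second_countable_topology}"
  assumes v: "square_integrable M v" and w: "square_integrable M w"
  shows "square_integrable M (\<lambda>x. v x + w x)"
proof -
  have meas: "(\<lambda>x. v x + w x) \<in> borel_measurable M"
    using v w by (auto simp: square_integrable_def)
  have "integrable M (\<lambda>x. (norm (v x + w x))\<^sup>2)"
  proof (rule Bochner_Integration.integrable_bound)
    show "integrable M (\<lambda>x. 2 * (norm (v x))\<^sup>2 + 2 * (norm (w x))\<^sup>2)"
      using v w by (simp add: square_integrable_def)
    have "(norm (a + b))\<^sup>2 \<le> 2 * (norm a)\<^sup>2 + 2 * (norm b)\<^sup>2" for a b :: 'b
    proof -
      have "(norm (a + b))\<^sup>2 \<le> (norm a + norm b)\<^sup>2"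
        by (intro power_mono norm_triangle_ineq) simp
      also have "\<dots> \<le> 2 * (norm a)\<^sup>2 + 2 * (norm b)\<^sup>2"
        using sum_squares_bound[of "norm a" "norm b"] by (simp add: power2_sum)
      finally show ?thesis .
    qed
    then show "AE x in M. norm ((norm (v x + w x))\<^sup>2) \<le> norm (2 * (norm (v x))\<^sup>2 + 2 * (norm (w x))\<^sup>2)"
      by (intro AE_I2) simp
  qed (use meas in measurable)
  with meas show ?thesis by (simp add: square_integrable_def)
qed

lemma square_integrable_scaleR:
  fixes v :: "'a \<Rightarrow> 'b::{real_normed_vector, second_countable_topology}"
  shows "square_integrable M v \<Longrightarrow> square_integrable M (\<lambda>x. a *\<^sub>R v x)"
  by (auto simp: square_integrable_def power_mult_distrib)

lemma square_integrable_scaleR_const: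
  fixes c :: "'b::{real_normed_vector, second_countable_topology}"
  shows "square_integrable M f \<Longrightarrow> square_integrable M (\<lambda>x. f x *\<^sub>R c)"
  by (auto simp: square_integrable_def power_mult_distrib)

lemma square_integrable_sum:
  fixes v :: "'i \<Rightarrow> 'a \<Rightarrow> 'b::{real_normed_vector, second_countable_topology}"
  shows "(\<And>i. i \<in> I \<Longrightarrow> square_integrable M (v i)) \<Longrightarrow> square_integrable M (\<lambda>x. \<Sum>i\<in>I. v i x)"
  by (induction I rule: infinite_finite_induct)
    (auto simp: square_integrable_add, auto simp: square_integrable_def)

lemma square_integrable_vec:
  fixes v :: "'a \<Rightarrow> real ^ 'n"
  assumes "\<And>i. square_integrable M (\<lambda>x. v x $ i)"
  shows "square_integrable M v"
proof -
  have "square_integrable M (\<lambda>x. \<Sum>i\<in>UNIV. v x $ i *\<^sub>R axis i (1::real))"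
    by (intro square_integrable_sum square_integrable_scaleR_const assms)
  then show ?thesis by (simp only: basis_expansion flip: scalar_mult_eq_scaleR)
qed

lemma square_integrable_Pair:
  fixes v :: "'a \<Rightarrow> 'b::{real_normed_vector, second_countable_topology}"
    and w :: "'a \<Rightarrow> 'c::{real_normed_vector, second_countable_topology}"
  assumes "square_integrable M v" "square_integrable M w"
  shows "square_integrable M (\<lambda>x. (v x, w x))"
  using assms by (auto simp: square_integrable_def norm_Pair)

lemma square_integrable_cong_AE:
  fixes v w :: "'a::euclidean_space \<Rightarrow> 'b::euclidean_space"
  assumes S: "S \<in> sets lebesgue" and v: "square_integrable (lebesgue_on S) v"
    and eq: "AE x in lebesgue_on S. v x = w x"
  shows "square_integrable (lebesgue_on S) w"
proof (rule square_integrable_bound[OF v])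
  show "w \<in> borel_measurable (lebesgue_on S)"
    by (rule borel_measurable_lebesgue_on_cong_AE[OF S square_integrable_measurable[OF v] eq])
  show "AE x in lebesgue_on S. norm (w x) \<le> norm (v x)" using eq by eventually_elim simp
qed

lemma L2_norm_cong_AE:
  fixes v w :: "'a \<Rightarrow> 'b::{real_normed_vector, second_countable_topology}"
  assumes "square_integrable M v" "square_integrable M w" "AE x in M. v x = w x"
  shows "L2_norm M v = L2_norm M w"
  unfolding L2_norm_def
proof (rule arg_cong[where f=sqrt], rule integral_cong_AE)
  show "AE x in M. (norm (v x))\<^sup>2 = (norm (w x))\<^sup>2" using assms(3) by eventually_elim simp
qed (use assms in \<open>auto simp: square_integrable_def\<close>)

lemma L2_norm_scaleR: "L2_norm M (\<lambda>x. a *\<^sub>R v x) = \<bar>a\<bar> * L2_norm M v"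
  by (simp add: L2_norm_def power_mult_distrib real_sqrt_mult)

lemma
  fixes v :: "'a \<Rightarrow> 'b::{real_normed_vector, second_countable_topology}"
    and w :: "'a \<Rightarrow> 'c::{real_normed_vector, second_countable_topology}"
  assumes v: "square_integrable M v" and w: "square_integrable M w"
  shows integrable_norm_mult_norm: "integrable M (\<lambda>x. norm (v x) * norm (w x))"
    and integral_norm_mult_norm_le: "(LINT x|M. norm (v x) * norm (w x)) \<le> L2_norm M v * L2_norm M w"
proof -
  have [measurable]: "v \<in> borel_measurable M" "w \<in> borel_measurable M"
    using v w by (auto simp: square_integrable_def)
  show int: "integrable M (\<lambda>x. norm (v x) * norm (w x))"
  proof (rule Bochner_Integration.integrable_bound)
    show "integrable M (\<lambda>x. (norm (v x))\<^sup>2 + (norm (w x))\<^sup>2)"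
      using v w by (simp add: square_integrable_def)
    have "a * b \<le> a\<^sup>2 + b\<^sup>2" if "0 \<le> a" "0 \<le> b" for a b :: real
      using sum_squares_bound[of a b] mult_nonneg_nonneg[OF that] by linarith
    then show "AE x in M. norm (norm (v x) * norm (w x)) \<le> norm ((norm (v x))\<^sup>2 + (norm (w x))\<^sup>2)"
      by (intro AE_I2) simp
  qed measurable
  let ?I = "LINT x|M. norm (v x) * norm (w x)"
  have square: "(\<integral>\<^sup>+x. (ennreal (f x))\<^sup>2 \<partial>M) = ennreal (LINT x|M. (f x)\<^sup>2)"
    if "integrable M (\<lambda>x. (f x)\<^sup>2)" "\<And>x. 0 \<le> f x" for f
    using that by (simp add: ennreal_power nn_integral_eq_integral)
  have "ennreal (?I\<^sup>2) = (\<integral>\<^sup>+x. ennreal (norm (v x)) * ennreal (norm (w x)) \<partial>M)\<^sup>2"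
    using int by (simp add: nn_integral_eq_integral ennreal_power flip: ennreal_mult)
  also have "\<dots> \<le> (\<integral>\<^sup>+x. (ennreal (norm (v x)))\<^sup>2 \<partial>M) * (\<integral>\<^sup>+x. (ennreal (norm (w x)))\<^sup>2 \<partial>M)"
    by (rule Cauchy_Schwarz_nn_integral) measurable
  also have "\<dots> = ennreal ((L2_norm M v)\<^sup>2 * (L2_norm M w)\<^sup>2)"
    using v w by (simp add: square square_integrable_def L2_norm_power2 ennreal_mult)
  finally have "?I\<^sup>2 \<le> (L2_norm M v * L2_norm M w)\<^sup>2"
    by (simp add: power_mult_distrib)
  then show "?I \<le> L2_norm M v * L2_norm M w"
    by (rule power2_le_imp_le) (simp add: L2_norm_nonneg)
qed

lemma L2_norm_triangle:
  fixes v w :: "'a \<Rightarrow> 'b::{real_normed_vector, second_countable_topology}"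
  assumes v: "square_integrable M v" and w: "square_integrable M w"
  shows "L2_norm M (\<lambda>x. v x + w x) \<le> L2_norm M v + L2_norm M w"
proof (rule power2_le_imp_le)
  note [simp] = v[THEN square_integrable_integrable] w[THEN square_integrable_integrable]
    integrable_norm_mult_norm[OF v w]
  have "(LINT x|M. (norm (v x + w x))\<^sup>2)
      \<le> (LINT x|M. (norm (v x))\<^sup>2 + 2 * (norm (v x) * norm (w x)) + (norm (w x))\<^sup>2)"
  proof (rule integral_mono)
    show "integrable M (\<lambda>x. (norm (v x + w x))\<^sup>2)"
      by (rule square_integrable_integrable[OF square_integrable_add[OF v w]])
    show "(norm (v x + w x))\<^sup>2 \<le> (norm (v x))\<^sup>2 + 2 * (norm (v x) * norm (w x)) + (norm (w x))\<^sup>2" for x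
      using power_mono[OF norm_triangle_ineq[of "v x" "w x"], of 2] by (simp add: power2_sum algebra_simps)
  qed simp
  also have "\<dots> = (L2_norm M v)\<^sup>2 + 2 * (LINT x|M. norm (v x) * norm (w x)) + (L2_norm M w)\<^sup>2"
    by (simp add: L2_norm_power2)
  also have "\<dots> \<le> (L2_norm M v + L2_norm M w)\<^sup>2"
    using integral_norm_mult_norm_le[OF v w] by (simp add: power2_sum)
  finally show "(L2_norm M (\<lambda>x. v x + w x))\<^sup>2 \<le> (L2_norm M v + L2_norm M w)\<^sup>2"
    by (simp add: L2_norm_power2)
qed (simp add: L2_norm_nonneg)

lemma L2_norm_Pair:
  assumes "square_integrable M v" "square_integrable M w"
  shows "L2_norm M (\<lambda>x. (v x, w x)) = sqrt ((L2_norm M v)\<^sup>2 + (L2_norm M w)\<^sup>2)"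
  using assms by (simp add: L2_norm_def norm_Pair square_integrable_def)

subsection \<open>The periodicity cell\<close>

lemma box_subset_Ycell: "box 0 (vec 2) \<subseteq> Ycell" and Ycell_subset_cbox: "Ycell \<subseteq> cbox 0 (vec 2)"
  by (auto simp: Ycell_def mem_box_cart less_imp_le)

lemma sets_Ycell: "Ycell \<in> sets lebesgue"
proof -
  have "Ycell = (\<Inter>i. {y. 0 \<le> y $ i} \<inter> {y. y $ i < 2})" by (auto simp: Ycell_def)
  also have "\<dots> \<in> sets borel"
    by (intro sets.finite_INT sets.Int borel_closed borel_open closed_Collect_le open_Collect_less
        continuous_intros) auto
  finally show ?thesis by simp
qed

interpretation Ycell: finite_measure "lebesgue_on Ycell"
  using bounded_set_imp_lmeasurable[OF bounded_subset[OF bounded_cbox Ycell_subset_cbox] sets_Ycell]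
  by (rule finite_measure_lebesgue_on)

lemma heis_mult_nth:
  "(p \<cdot>\<^sub>H q) $ 1 = p $ 1 + q $ 1" "(p \<cdot>\<^sub>H q) $ 2 = p $ 2 + q $ 2"
  "(p \<cdot>\<^sub>H q) $ 3 = p $ 3 + q $ 3 + 2 * (p $ 2 * q $ 1 - p $ 1 * q $ 2)"
  by (simp_all add: heis_mult_def vector_3)

lemma ex_lattice_translate_in_Ycell: "\<exists>k. lattice_pt k \<cdot>\<^sub>H x \<in> Ycell"
proof -
  have floor: "0 \<le> 2 * real_of_int (- \<lfloor>s / 2\<rfloor>) + s" "2 * real_of_int (- \<lfloor>s / 2\<rfloor>) + s < 2" for s
    using floor_correct[of "s / 2"] by linarith+
  define k1 k2 where "k1 = - \<lfloor>x $ 1 / 2\<rfloor>" and "k2 = - \<lfloor>x $ 2 / 2\<rfloor>"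
  define s where "s = x $ 3 + 2 * (2 * real_of_int k2 * x $ 1 - 2 * real_of_int k1 * x $ 2)"
  define k3 where "k3 = - \<lfloor>s / 2\<rfloor>"
  have "lattice_pt (vector [k1, k2, k3]) \<cdot>\<^sub>H x \<in> Ycell"
    using floor[of "x $ 1"] floor[of "x $ 2"] floor[of s]
    unfolding Ycell_def mem_Collect_eq forall_3 heis_mult_nth lattice_pt_def vec_lambda_beta vector_3
      k1_def[symmetric] k2_def[symmetric] k3_def[symmetric] by (auto simp: s_def)
  then show ?thesis by blast
qed

lemma negligible_heis_translate_vimage:
  assumes "negligible N" shows "negligible {x. p \<cdot>\<^sub>H x \<in> N}"
proof -
  define L :: "heis \<Rightarrow> heis" where "L x = vector [x $ 1, x $ 2, x $ 3 + 2 * (p $ 2 * x $ 1 - p $ 1 * x $ 2)]" for x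
  have translate: "(\<lambda>x. p \<cdot>\<^sub>H x) = (\<lambda>x. p + L x)"
    by (auto simp: vec_eq_iff forall_3 heis_mult_nth L_def vector_3)
  have "linear L" by (rule linearI) (auto simp: L_def vec_eq_iff forall_3 vector_3 algebra_simps)
  then have "(L has_derivative L) (at x within UNIV)" for x
    by (simp add: linear_conv_bounded_linear bounded_linear_imp_has_derivative)
  then have "((\<lambda>x. p \<cdot>\<^sub>H x) has_derivative L) (at x within UNIV)" for x
    unfolding translate by (auto intro!: derivative_eq_intros)
  moreover have "inj L" by (rule injI) (auto simp: L_def vec_eq_iff forall_3 vector_3)
  ultimately show ?thesis
    using negligible_differentiable_vimage[OF assms, of UNIV "\<lambda>x. L" "\<lambda>x. p \<cdot>\<^sub>H x"] by simp
qed

lemma AE_if_Yperiodic_and_AE_Ycell: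
  assumes P: "Yperiodic P" and AE: "AE y in lebesgue_on Ycell. P y"
  shows "AE y in lebesgue. P y"
proof -
  define N where "N = {y. \<not> (y \<in> Ycell \<longrightarrow> P y)}"
  have "AE y in lebesgue. y \<in> Ycell \<longrightarrow> P y"
    using AE by (simp add: AE_restrict_space_iff sets_Ycell)
  then have "N \<in> null_sets lebesgue" unfolding N_def
    by (simp add: completion.AE_iff_null_sets)
  then have N: "negligible N" by (simp add: negligible_iff_null_sets)
  have "negligible (\<Union>p\<in>range lattice_pt. {x. p \<cdot>\<^sub>H x \<in> N})"
    by (intro negligible_countable_Union) (auto intro!: negligible_heis_translate_vimage N countable_image)
  moreover have "{x \<in> space lebesgue. \<not> P x} \<subseteq> (\<Union>p\<in>range lattice_pt. {x. p \<cdot>\<^sub>H x \<in> N})"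
  proof
    fix x assume "x \<in> {x \<in> space lebesgue. \<not> P x}"
    moreover obtain k where "lattice_pt k \<cdot>\<^sub>H x \<in> Ycell" using ex_lattice_translate_in_Ycell by blast
    ultimately show "x \<in> (\<Union>p\<in>range lattice_pt. {x. p \<cdot>\<^sub>H x \<in> N})"
      using P by (auto simp: N_def Yperiodic_def)
  qed
  ultimately show ?thesis by (intro AE_I') (auto simp: negligible_iff_null_sets)
qed

subsection \<open>Periodic Sobolev functions\<close>

lemma AE_Ycell_if_AE_UNIV: "AE y in lebesgue_on UNIV. P y \<Longrightarrow> AE y in lebesgue_on Ycell. P y"
  by (rule AE_lebesgue_on_subset) (auto simp: sets_Ycell)

lemma dil_1_image: "dil 1 ` S = S"
proof -
  have "dil 1 = id" by (auto simp: dil_def vec_eq_iff forall_3 vector_3)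
  then show ?thesis by simp
qed

lemma wX_in_L2:
  assumes "open \<Omega>" "S \<in> sets lebesgue" "S \<subseteq> \<Omega>" and g: "is_weak_X i \<Omega> f g" "g \<in> L2 S"
  shows "wX i \<Omega> f \<in> L2 S"
proof -
  have "AE x in lebesgue_on S. wX i \<Omega> f x = g x"
    by (rule AE_lebesgue_on_subset[OF wX_eq_AE[OF \<open>open \<Omega>\<close> g(1)] assms(3) _ assms(2)])
      (use \<open>open \<Omega>\<close> in simp)
  from square_integrable_cong_AE[OF assms(2) _ AE_symmetric[OF this]] g(2) show ?thesis
    by (simp add: L2_iff_square_integrable)
qed

lemma H1perD:
  assumes "f \<in> H1per"
  shows "Yperiodic f" "square_integrable (lebesgue_on Ycell) f" "weakly_X_differentiable UNIV f"
    "square_integrable (lebesgue_on Ycell) (wX i UNIV f)"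
    "square_integrable (lebesgue_on Ycell) (hgrad UNIV f)"
proof -
  show "Yperiodic f" "square_integrable (lebesgue_on Ycell) f"
    using assms by (auto simp: H1per_def L2per_def L2_iff_square_integrable)
  show "weakly_X_differentiable UNIV f"
    using assms by (intro weakly_X_differentiableI) (auto simp: H1per_def)
  show wX: "square_integrable (lebesgue_on Ycell) (wX i UNIV f)" for i
  proof -
    obtain g where g: "is_weak_X i UNIV f g" "\<forall>l>0. g \<in> L2 (dil l ` Ycell)"
      using assms by (auto simp: H1per_def)
    from g(2)[rule_format, of 1] have "g \<in> L2 Ycell" by (simp add: dil_1_image)
    with wX_in_L2[OF open_UNIV sets_Ycell _ g(1)] show ?thesis
      by (simp add: L2_iff_square_integrable)
  qed
  show "square_integrable (lebesgue_on Ycell) (hgrad UNIV f)"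
    by (intro square_integrable_vec) (simp add: hgrad_def wX)
qed

lemma H1per_linear:
  assumes "f \<in> H1per" "g \<in> H1per"
  shows "(\<lambda>y. a * f y + b * g y) \<in> H1per"
proof -
  have L2: "(\<lambda>y. a * v y + b * w y) \<in> L2 S" if "v \<in> L2 S" "w \<in> L2 S" for v w S
    using that square_integrable_add[OF square_integrable_scaleR[of _ v a] square_integrable_scaleR[of _ w b]]
    by (simp add: L2_iff_square_integrable)
  have "\<exists>h. is_weak_X i UNIV (\<lambda>y. a * f y + b * g y) h \<and> (\<forall>l>0. h \<in> L2 (dil l ` Ycell))" for i
  proof -
    obtain f' g' where f': "is_weak_X i UNIV f f'" "\<forall>l>0. f' \<in> L2 (dil l ` Ycell)"
      and g': "is_weak_X i UNIV g g'" "\<forall>l>0. g' \<in> L2 (dil l ` Ycell)"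
      using assms unfolding H1per_def by blast
    show ?thesis
      using is_weak_X_linear[OF _ f'(1) g'(1), of a b] L2 f'(2) g'(2) by auto
  qed
  moreover have "(\<lambda>y. a * f y + b * g y) \<in> L2per"
    using assms by (auto simp: H1per_def L2per_def Yperiodic_def L2)
  ultimately show ?thesis by (simp add: H1per_def)
qed

lemma H1per_const: "(\<lambda>y. c) \<in> H1per"
proof -
  have "is_weak_X i UNIV (\<lambda>y. c) (\<lambda>y. 0)" for i by (rule is_weak_X_const) simp
  moreover have "(\<lambda>y. 0) \<in> L2 S" for S by (simp add: L2_def)
  moreover have "(\<lambda>y. c) \<in> L2 Ycell"
    using Ycell.square_integrable_const[of c] by (simp add: L2_iff_square_integrable)
  ultimately show ?thesis by (auto simp: H1per_def L2per_def Yperiodic_def)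
qed

lemma H1per_add: "f \<in> H1per \<Longrightarrow> g \<in> H1per \<Longrightarrow> (\<lambda>y. f y + g y) \<in> H1per"
  and H1per_diff: "f \<in> H1per \<Longrightarrow> g \<in> H1per \<Longrightarrow> (\<lambda>y. f y - g y) \<in> H1per"
  and H1per_scale: "f \<in> H1per \<Longrightarrow> (\<lambda>y. r * f y) \<in> H1per"
  using H1per_linear[of f g 1 1] H1per_linear[of f g 1 "-1"] H1per_linear[of f f r 0] by simp_all

lemma hgrad_linear_AE_Ycell:
  assumes "f \<in> H1per" "g \<in> H1per"
  shows "AE y in lebesgue_on Ycell.
    hgrad UNIV (\<lambda>y. a * f y + b * g y) y = a *\<^sub>R hgrad UNIV f y + b *\<^sub>R hgrad UNIV g y"
  by (intro AE_Ycell_if_AE_UNIV hgrad_linear_AE H1perD(3) assms open_UNIV)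

lemma hgrad_add_AE_Ycell:
  assumes "f \<in> H1per" "g \<in> H1per"
  shows "AE y in lebesgue_on Ycell. hgrad UNIV (\<lambda>y. f y + g y) y = hgrad UNIV f y + hgrad UNIV g y"
  using hgrad_linear_AE_Ycell[OF assms, of 1 1] by simp

lemma hgrad_diff_AE_Ycell:
  assumes "f \<in> H1per" "g \<in> H1per"
  shows "AE y in lebesgue_on Ycell. hgrad UNIV (\<lambda>y. f y - g y) y = hgrad UNIV f y - hgrad UNIV g y"
  using hgrad_linear_AE_Ycell[OF assms, of 1 "-1"] by simp

lemma hgrad_const_AE_Ycell: "AE y in lebesgue_on Ycell. hgrad UNIV (\<lambda>y. c) y = 0"
  by (intro AE_Ycell_if_AE_UNIV hgrad_const_AE open_UNIV)

lemma hgrad_add_const_AE_Ycell: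
  assumes "f \<in> H1per"
  shows "AE y in lebesgue_on Ycell. hgrad UNIV (\<lambda>y. f y + c) y = hgrad UNIV f y"
  using hgrad_add_AE_Ycell[OF assms H1per_const, of c] hgrad_const_AE_Ycell[of c]
  by eventually_elim simp

lemma AE_const_if_hgrad_eq_0:
  assumes f: "f \<in> H1per" and grad: "AE y in lebesgue_on Ycell. hgrad UNIV f y = 0"
  shows "\<exists>c. AE y in lebesgue. f y = c"
proof -
  let ?B = "box 0 (vec 2) :: heis set"
  have "is_weak_X i ?B f (\<lambda>y. 0)" for i
  proof (rule is_weak_X_cong_AE)
    show "is_weak_X i ?B f (wX i UNIV f)"
      by (rule is_weak_X_subset[of i UNIV])
        (use H1perD(3)[OF f] in \<open>simp_all add: weakly_X_differentiable_def\<close>)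
    show "AE y in lebesgue_on ?B. wX i UNIV f y = 0"
      using AE_lebesgue_on_subset[OF grad box_subset_Ycell sets_Ycell]
      by (auto simp: hgrad_def vec_eq_iff elim!: eventually_mono)
  qed simp
  then obtain c where "AE y in lebesgue_on ?B. f y = c"
    using AE_const_on_box_if_weak_X_zero by blast
  then have "AE y in lebesgue_on Ycell. f y = c"
    using AE_lebesgue_on_subset[OF AE_lebesgue_on_cbox_if_box Ycell_subset_cbox] sets_Ycell by auto
  then have "AE y in lebesgue. f y = c"
    by (rule AE_if_Yperiodic_and_AE_Ycell[rotated]) (use H1perD(1)[OF f] in \<open>simp add: Yperiodic_def\<close>)
  then show ?thesis ..
qed

subsection \<open>The quotient norm\<close>

lemma square_integrable_jet:
  assumes "f \<in> H1per" shows "square_integrable (lebesgue_on Ycell) (\<lambda>y. (f y, hgrad UNIV f y))"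
  by (intro square_integrable_Pair H1perD assms)

lemma H1per_norm_eq_L2_norm:
  assumes "f \<in> H1per"
  shows "H1per_norm f = L2_norm (lebesgue_on Ycell) (\<lambda>y. (f y, hgrad UNIV f y))"
proof -
  have "integrable (lebesgue_on Ycell) (\<lambda>y. (wX i UNIV f y)\<^sup>2)" for i
    using square_integrable_integrable[OF H1perD(4)[OF assms]] by simp
  then have "(\<Sum>i\<in>UNIV. LINT y|lebesgue_on Ycell. (wX i UNIV f y)\<^sup>2)
      = (LINT y|lebesgue_on Ycell. (norm (hgrad UNIV f y))\<^sup>2)"
    by (simp add: norm_vec_def L2_set_def sum_nonneg hgrad_def)
  then show ?thesis
    unfolding H1per_norm_def L2_norm_Pair[OF H1perD(2,5)[OF assms]] by (simp add: L2_norm_power2)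
qed

lemma H1per_norm_nonneg: "f \<in> H1per \<Longrightarrow> H1per_norm f \<ge> 0"
  by (simp add: H1per_norm_eq_L2_norm L2_norm_nonneg)

lemma H1per_norm_triangle:
  assumes f: "f \<in> H1per" and g: "g \<in> H1per"
  shows "H1per_norm (\<lambda>y. f y + g y) \<le> H1per_norm f + H1per_norm g"
proof -
  let ?M = "lebesgue_on Ycell"
  have fg: "(\<lambda>y. f y + g y) \<in> H1per" by (intro H1per_add f g)
  have "L2_norm ?M (\<lambda>y. (f y + g y, hgrad UNIV (\<lambda>y. f y + g y) y))
      = L2_norm ?M (\<lambda>y. (f y, hgrad UNIV f y) + (g y, hgrad UNIV g y))"
  proof (rule L2_norm_cong_AE[OF square_integrable_jet[OF fg]])
    show "square_integrable ?M (\<lambda>y. (f y, hgrad UNIV f y) + (g y, hgrad UNIV g y))"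
      by (intro square_integrable_add square_integrable_jet f g)
    show "AE y in ?M. (f y + g y, hgrad UNIV (\<lambda>y. f y + g y) y) = (f y, hgrad UNIV f y) + (g y, hgrad UNIV g y)"
      using hgrad_add_AE_Ycell[OF f g] by eventually_elim simp
  qed
  also have "\<dots> \<le> L2_norm ?M (\<lambda>y. (f y, hgrad UNIV f y)) + L2_norm ?M (\<lambda>y. (g y, hgrad UNIV g y))"
    by (intro L2_norm_triangle square_integrable_jet f g)
  finally show ?thesis by (simp add: H1per_norm_eq_L2_norm f g fg)
qed

lemma H1per_norm_scale:
  assumes f: "f \<in> H1per"
  shows "H1per_norm (\<lambda>y. r * f y) = \<bar>r\<bar> * H1per_norm f"
proof -
  let ?M = "lebesgue_on Ycell"
  have rf: "(\<lambda>y. r * f y) \<in> H1per" by (intro H1per_scale f)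
  have "L2_norm ?M (\<lambda>y. (r * f y, hgrad UNIV (\<lambda>y. r * f y) y)) = L2_norm ?M (\<lambda>y. r *\<^sub>R (f y, hgrad UNIV f y))"
  proof (rule L2_norm_cong_AE[OF square_integrable_jet[OF rf]])
    show "square_integrable ?M (\<lambda>y. r *\<^sub>R (f y, hgrad UNIV f y))"
      by (intro square_integrable_scaleR square_integrable_jet f)
    show "AE y in ?M. (r * f y, hgrad UNIV (\<lambda>y. r * f y) y) = r *\<^sub>R (f y, hgrad UNIV f y)"
      using hgrad_linear_AE_Ycell[OF f f, of r 0] by simp
  qed
  also have "\<dots> = \<bar>r\<bar> * L2_norm ?M (\<lambda>y. (f y, hgrad UNIV f y))"
    by (rule L2_norm_scaleR)
  finally show ?thesis by (simp add: H1per_norm_eq_L2_norm f rf)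
qed

lemma quot_norm_le: "f \<in> H1per \<Longrightarrow> quot_norm f \<le> H1per_norm (\<lambda>y. f y + c)"
  unfolding quot_norm_def
  by (rule cINF_lower) (auto intro!: bdd_belowI[of _ 0] H1per_norm_nonneg H1per_add H1per_const)

lemma quot_norm_greatest: "(\<And>c. b \<le> H1per_norm (\<lambda>y. f y + c)) \<Longrightarrow> b \<le> quot_norm f"
  unfolding quot_norm_def by (rule cINF_greatest) auto

lemma quot_norm_nonneg: "f \<in> H1per \<Longrightarrow> quot_norm f \<ge> 0"
  by (intro quot_norm_greatest H1per_norm_nonneg H1per_add H1per_const)

lemma quot_norm_triangle:
  assumes f: "f \<in> H1per" and g: "g \<in> H1per"
  shows "quot_norm (\<lambda>y. f y + g y) \<le> quot_norm f + quot_norm g"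
proof -
  have "quot_norm (\<lambda>y. f y + g y) \<le> H1per_norm (\<lambda>y. f y + c) + H1per_norm (\<lambda>y. g y + d)" for c d
  proof -
    have "quot_norm (\<lambda>y. f y + g y) \<le> H1per_norm (\<lambda>y. (f y + g y) + (c + d))"
      by (intro quot_norm_le H1per_add f g)
    also have "(\<lambda>y. (f y + g y) + (c + d)) = (\<lambda>y. (f y + c) + (g y + d))" by (simp add: algebra_simps)
    also have "H1per_norm \<dots> \<le> H1per_norm (\<lambda>y. f y + c) + H1per_norm (\<lambda>y. g y + d)"
      by (intro H1per_norm_triangle H1per_add H1per_const f g)
    finally show ?thesis .
  qed
  then have "quot_norm (\<lambda>y. f y + g y) - H1per_norm (\<lambda>y. g y + d) \<le> quot_norm f" for d
    by (intro quot_norm_greatest) (simp add: diff_le_eq)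
  then have "quot_norm (\<lambda>y. f y + g y) - quot_norm f \<le> quot_norm g"
    by (intro quot_norm_greatest) (simp add: algebra_simps)
  then show ?thesis by simp
qed

lemma quot_norm_scale_le:
  assumes f: "f \<in> H1per"
  shows "quot_norm (\<lambda>y. r * f y) \<le> \<bar>r\<bar> * quot_norm f"
proof (cases "r = 0")
  case True
  then show ?thesis
    using quot_norm_le[OF H1per_const, of 0 0] H1per_norm_scale[OF H1per_const, of 0 0] by simp
next
  case False
  have "quot_norm (\<lambda>y. r * f y) \<le> \<bar>r\<bar> * H1per_norm (\<lambda>y. f y + c)" for c
  proof -
    have "quot_norm (\<lambda>y. r * f y) \<le> H1per_norm (\<lambda>y. r * f y + r * c)"
      by (intro quot_norm_le H1per_scale f)
    also have "\<dots> = \<bar>r\<bar> * H1per_norm (\<lambda>y. f y + c)"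
      by (simp add: H1per_norm_scale[symmetric] H1per_add H1per_const f distrib_left)
    finally show ?thesis .
  qed
  then have "quot_norm (\<lambda>y. r * f y) / \<bar>r\<bar> \<le> quot_norm f"
    using False by (intro quot_norm_greatest) (simp add: pos_divide_le_eq mult.commute)
  then show ?thesis using False by (simp add: pos_divide_le_eq mult.commute)
qed

lemma quot_norm_diff_le:
  assumes "f \<in> H1per" "g \<in> H1per"
  shows "quot_norm (\<lambda>y. f y - g y) \<le> quot_norm f + quot_norm g"
  using quot_norm_triangle[OF assms(1) H1per_scale[OF assms(2), of "-1"]] quot_norm_scale_le[OF assms(2), of "-1"]
  by simp

lemma abs_quot_norm_diff_le:
  assumes f: "f \<in> H1per" and g: "g \<in> H1per"
  shows "\<bar>quot_norm f - quot_norm g\<bar> \<le> quot_norm (\<lambda>y. f y - g y)"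
proof -
  have "quot_norm f \<le> quot_norm (\<lambda>y. f y - g y) + quot_norm g"
    using quot_norm_triangle[OF H1per_diff[OF f g] g] by simp
  moreover have "quot_norm g \<le> quot_norm f + quot_norm (\<lambda>y. f y - g y)"
    using quot_norm_diff_le[OF f H1per_diff[OF f g]] by simp
  ultimately show ?thesis by simp
qed

lemma L2_norm_hgrad_le_quot_norm:
  assumes f: "f \<in> H1per"
  shows "L2_norm (lebesgue_on Ycell) (hgrad UNIV f) \<le> quot_norm f"
proof (rule quot_norm_greatest)
  fix c
  have fc: "(\<lambda>y. f y + c) \<in> H1per" by (intro H1per_add H1per_const f)
  have "L2_norm (lebesgue_on Ycell) (hgrad UNIV f) = L2_norm (lebesgue_on Ycell) (hgrad UNIV (\<lambda>y. f y + c))"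
    by (intro L2_norm_cong_AE H1perD f fc AE_symmetric[OF hgrad_add_const_AE_Ycell])
  also have "\<dots> \<le> H1per_norm (\<lambda>y. f y + c)"
    by (simp add: H1per_norm_eq_L2_norm fc L2_norm_Pair H1perD real_le_rsqrt)
  finally show "L2_norm (lebesgue_on Ycell) (hgrad UNIV f) \<le> H1per_norm (\<lambda>y. f y + c)" .
qed

subsection \<open>Strongly measurable maps into the quotient\<close>

definition quot_tendsto :: "(nat \<Rightarrow> heis \<Rightarrow> real) \<Rightarrow> (heis \<Rightarrow> real) \<Rightarrow> bool" where
  "quot_tendsto F f \<longleftrightarrow> (\<lambda>n. quot_norm (\<lambda>y. F n y - f y)) \<longlonglongrightarrow> 0"

lemma quot_tendsto_if_dominated:
  assumes "\<And>n. F n \<in> H1per" "f \<in> H1per"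
    and "\<And>n. quot_norm (\<lambda>y. F n y - f y) \<le> r n" "r \<longlonglongrightarrow> 0"
  shows "quot_tendsto F f"
  unfolding quot_tendsto_def
  by (rule Lim_null_comparison[OF _ assms(4)])
    (simp add: assms(1-3) quot_norm_nonneg H1per_diff always_eventually)

lemma quot_tendsto_diff:
  assumes F: "\<And>n. F n \<in> H1per" "f \<in> H1per" "quot_tendsto F f"
    and G: "\<And>n. G n \<in> H1per" "g \<in> H1per" "quot_tendsto G g"
  shows "quot_tendsto (\<lambda>n y. F n y - G n y) (\<lambda>y. f y - g y)"
proof (rule quot_tendsto_if_dominated)
  show "quot_norm (\<lambda>y. (F n y - G n y) - (f y - g y))
      \<le> quot_norm (\<lambda>y. F n y - f y) + quot_norm (\<lambda>y. G n y - g y)" for n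
    using quot_norm_diff_le[OF H1per_diff[OF F(1,2)] H1per_diff[OF G(1,2)], of n n] by (simp add: algebra_simps)
  show "(\<lambda>n. quot_norm (\<lambda>y. F n y - f y) + quot_norm (\<lambda>y. G n y - g y)) \<longlonglongrightarrow> 0"
    using tendsto_add[OF F(3)[unfolded quot_tendsto_def] G(3)[unfolded quot_tendsto_def]] by simp
qed (intro H1per_diff F G)+

lemma quot_tendsto_scale:
  assumes "c \<longlonglongrightarrow> r" "f \<in> H1per"
  shows "quot_tendsto (\<lambda>n y. c n * f y) (\<lambda>y. r * f y)"
proof (rule quot_tendsto_if_dominated)
  show "quot_norm (\<lambda>y. c n * f y - r * f y) \<le> \<bar>c n - r\<bar> * quot_norm f" for n
    using quot_norm_scale_le[OF assms(2), of "c n - r"] by (simp add: left_diff_distrib)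
  show "(\<lambda>n. \<bar>c n - r\<bar> * quot_norm f) \<longlonglongrightarrow> 0"
    using assms(1) by (intro tendsto_mult_left_zero tendsto_rabs_zero LIM_zero)
qed (intro H1per_scale assms)+

lemma quot_tendsto_imp_tendsto_quot_norm:
  assumes "\<And>n. F n \<in> H1per" "f \<in> H1per" "quot_tendsto F f"
  shows "(\<lambda>n. quot_norm (F n)) \<longlonglongrightarrow> quot_norm f"
proof (rule LIM_zero_cancel, rule Lim_null_comparison)
  show "\<forall>\<^sub>F n in sequentially. norm (quot_norm (F n) - quot_norm f) \<le> quot_norm (\<lambda>y. F n y - f y)"
    by (simp add: abs_quot_norm_diff_le assms always_eventually)
qed (use assms in \<open>simp add: quot_tendsto_def\<close>)

definition strongly_measurable :: "heis set \<Rightarrow> (heis \<Rightarrow> heis \<Rightarrow> real) \<Rightarrow> bool" where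
  "strongly_measurable \<Omega> w \<longleftrightarrow> (\<exists>s :: nat \<Rightarrow> heis \<Rightarrow> heis \<Rightarrow> real.
     (\<forall>n. simple_function (lebesgue_on \<Omega>) (s n) \<and> s n ` \<Omega> \<subseteq> H1per) \<and>
     (AE x in lebesgue_on \<Omega>. quot_tendsto (\<lambda>n. s n x) (w x)))"

lemma strongly_measurableE:
  assumes "strongly_measurable \<Omega> w"
  obtains s where "\<And>n. simple_function (lebesgue_on \<Omega>) (s n)" "\<And>n x. x \<in> \<Omega> \<Longrightarrow> s n x \<in> H1per"
    "AE x in lebesgue_on \<Omega>. x \<in> \<Omega> \<and> quot_tendsto (\<lambda>n. s n x) (w x)"
proof -
  obtain s :: "nat \<Rightarrow> heis \<Rightarrow> heis \<Rightarrow> real" where approx: "\<And>n. simple_function (lebesgue_on \<Omega>) (s n)"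
    "\<And>n. s n ` \<Omega> \<subseteq> H1per" "AE x in lebesgue_on \<Omega>. quot_tendsto (\<lambda>n. s n x) (w x)"
    using assms unfolding strongly_measurable_def by blast
  show thesis
  proof (rule that[OF approx(1)])
    show "s n x \<in> H1per" if "x \<in> \<Omega>" for n x using approx(2) that by blast
    show "AE x in lebesgue_on \<Omega>. x \<in> \<Omega> \<and> quot_tendsto (\<lambda>n. s n x) (w x)"
      using approx(3) by (rule lebesgue_on_mono) simp
  qed
qed

lemma borel_measurable_quot_continuous:
  assumes \<Omega>: "\<Omega> \<in> sets lebesgue" and w: "\<And>x. x \<in> \<Omega> \<Longrightarrow> w x \<in> H1per" "strongly_measurable \<Omega> w"
    and continuous: "\<And>F f. (\<And>n. F n \<in> H1per) \<Longrightarrow> f \<in> H1per \<Longrightarrow> quot_tendsto F f \<Longrightarrow> (\<lambda>n. p (F n) :: real) \<longlonglongrightarrow> p f"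
  shows "(\<lambda>x. p (w x)) \<in> borel_measurable (lebesgue_on \<Omega>)"
proof -
  obtain s where approx: "\<And>n. simple_function (lebesgue_on \<Omega>) (s n)" "\<And>n x. x \<in> \<Omega> \<Longrightarrow> s n x \<in> H1per"
    "AE x in lebesgue_on \<Omega>. x \<in> \<Omega> \<and> quot_tendsto (\<lambda>n. s n x) (w x)"
    by (rule strongly_measurableE[OF w(2)]) (rule that; assumption)
  have "(\<lambda>x. p (s n x)) \<in> borel_measurable (lebesgue_on \<Omega>)" for n
    using simple_function_compose[OF approx(1)[of n], of p]
    by (intro borel_measurable_simple_function) (simp add: comp_def)
  then have "(\<lambda>x. lim (\<lambda>n. p (s n x))) \<in> borel_measurable (lebesgue_on \<Omega>)"
    by (rule borel_measurable_lim_metric)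
  moreover have "AE x in lebesgue_on \<Omega>. lim (\<lambda>n. p (s n x)) = p (w x)"
    using approx(3) by eventually_elim (auto intro!: limI continuous approx(2) w(1))
  ultimately show ?thesis by (rule borel_measurable_lebesgue_on_cong_AE[OF \<Omega>])
qed

lemma strongly_measurable_diff:
  assumes v: "\<And>x. x \<in> \<Omega> \<Longrightarrow> v x \<in> H1per" "strongly_measurable \<Omega> v"
    and w: "\<And>x. x \<in> \<Omega> \<Longrightarrow> w x \<in> H1per" "strongly_measurable \<Omega> w"
  shows "strongly_measurable \<Omega> (\<lambda>x y. v x y - w x y)"
proof -
  obtain s where approx_v: "\<And>n. simple_function (lebesgue_on \<Omega>) (s n)" "\<And>n x. x \<in> \<Omega> \<Longrightarrow> s n x \<in> H1per"
    "AE x in lebesgue_on \<Omega>. x \<in> \<Omega> \<and> quot_tendsto (\<lambda>n. s n x) (v x)"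
    by (rule strongly_measurableE[OF v(2)]) (rule that; assumption)
  obtain t where approx_w: "\<And>n. simple_function (lebesgue_on \<Omega>) (t n)" "\<And>n x. x \<in> \<Omega> \<Longrightarrow> t n x \<in> H1per"
    "AE x in lebesgue_on \<Omega>. x \<in> \<Omega> \<and> quot_tendsto (\<lambda>n. t n x) (w x)"
    by (rule strongly_measurableE[OF w(2)]) (rule that; assumption)
  have "simple_function (lebesgue_on \<Omega>) (\<lambda>x y. s n x y - t n x y)" for n
    using simple_function_compose2[OF approx_v(1)[of n] approx_w(1)[of n], of "\<lambda>f g y. f y - g y"] .
  moreover have "(\<lambda>x y. s n x y - t n x y) ` \<Omega> \<subseteq> H1per" for n
    using approx_v(2) approx_w(2) by (auto intro!: H1per_diff)
  moreover have "AE x in lebesgue_on \<Omega>. quot_tendsto (\<lambda>n y. s n x y - t n x y) (\<lambda>y. v x y - w x y)"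
    using approx_v(3) approx_w(3)
    by eventually_elim (auto intro!: quot_tendsto_diff approx_v(2) approx_w(2) v(1) w(1))
  ultimately show ?thesis
    unfolding strongly_measurable_def by (intro exI[of _ "\<lambda>n x y. s n x y - t n x y"] conjI allI)
qed

lemma strongly_measurable_scale:
  assumes g: "g \<in> borel_measurable (lebesgue_on \<Omega>)" and Z: "Z \<in> H1per"
  shows "strongly_measurable \<Omega> (\<lambda>x y. g x * Z y)"
proof -
  obtain c where approx: "\<And>n. simple_function (lebesgue_on \<Omega>) (c n)" "\<And>x. x \<in> \<Omega> \<Longrightarrow> (\<lambda>n. c n x) \<longlonglongrightarrow> g x"
    using borel_measurable_implies_sequence_metric[OF g, of 0] by auto
  have "simple_function (lebesgue_on \<Omega>) (\<lambda>x y. c n x * Z y)" for n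
    using simple_function_compose1[OF approx(1)[of n], of "\<lambda>r y. r * Z y"] .
  moreover have "(\<lambda>x y. c n x * Z y) ` \<Omega> \<subseteq> H1per" for n by (auto intro!: H1per_scale Z)
  moreover have "AE x in lebesgue_on \<Omega>. quot_tendsto (\<lambda>n y. c n x * Z y) (\<lambda>y. g x * Z y)"
    by (intro AE_I2 quot_tendsto_scale approx(2) Z) simp
  ultimately show ?thesis
    unfolding strongly_measurable_def by (intro exI[of _ "\<lambda>n x y. c n x * Z y"] conjI allI)
qed

lemma quot_norm_measurable:
  assumes "\<Omega> \<in> sets lebesgue" "\<And>x. x \<in> \<Omega> \<Longrightarrow> w x \<in> H1per" "strongly_measurable \<Omega> w"
  shows "(\<lambda>x. quot_norm (w x)) \<in> borel_measurable (lebesgue_on \<Omega>)"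
  by (rule borel_measurable_quot_continuous[OF assms quot_tendsto_imp_tendsto_quot_norm])

lemma L2_H1per_quot_iff:
  assumes "\<Omega> \<in> sets lebesgue"
  shows "w \<in> L2_H1per_quot \<Omega> \<longleftrightarrow> (\<forall>x\<in>\<Omega>. w x \<in> H1per) \<and> strongly_measurable \<Omega> w
     \<and> square_integrable (lebesgue_on \<Omega>) (\<lambda>x. quot_norm (w x))"
proof -
  have "w \<in> L2_H1per_quot \<Omega> \<longleftrightarrow> (\<forall>x\<in>\<Omega>. w x \<in> H1per) \<and> strongly_measurable \<Omega> w
      \<and> integrable (lebesgue_on \<Omega>) (\<lambda>x. (quot_norm (w x))\<^sup>2)"
    unfolding L2_H1per_quot_def strongly_measurable_def quot_tendsto_def by blast
  then show ?thesis
    using quot_norm_measurable[OF assms] by (auto simp: square_integrable_def)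
qed

lemma L2_H1per_quot_diff:
  assumes \<Omega>: "\<Omega> \<in> sets lebesgue" and v: "v \<in> L2_H1per_quot \<Omega>" and w: "w \<in> L2_H1per_quot \<Omega>"
  shows "(\<lambda>x y. v x y - w x y) \<in> L2_H1per_quot \<Omega>"
proof -
  have in_H1per: "v x \<in> H1per" "w x \<in> H1per" if "x \<in> \<Omega>" for x
    using v w that by (auto simp: L2_H1per_quot_iff[OF \<Omega>])
  have meas: "strongly_measurable \<Omega> (\<lambda>x y. v x y - w x y)"
    using v w by (intro strongly_measurable_diff) (auto simp: L2_H1per_quot_iff[OF \<Omega>])
  have "square_integrable (lebesgue_on \<Omega>) (\<lambda>x. quot_norm (\<lambda>y. v x y - w x y))"
  proof (rule square_integrable_bound)
    show "square_integrable (lebesgue_on \<Omega>) (\<lambda>x. quot_norm (v x) + quot_norm (w x))"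
      using v w by (intro square_integrable_add) (auto simp: L2_H1per_quot_iff[OF \<Omega>])
    show "(\<lambda>x. quot_norm (\<lambda>y. v x y - w x y)) \<in> borel_measurable (lebesgue_on \<Omega>)"
      by (rule quot_norm_measurable[OF \<Omega> _ meas]) (intro H1per_diff in_H1per)
    show "AE x in lebesgue_on \<Omega>. norm (quot_norm (\<lambda>y. v x y - w x y)) \<le> norm (quot_norm (v x) + quot_norm (w x))"
      by (intro AE_I2) (simp add: quot_norm_nonneg quot_norm_diff_le in_H1per H1per_diff)
  qed
  with meas in_H1per show ?thesis by (simp add: L2_H1per_quot_iff[OF \<Omega>] H1per_diff)
qed

lemma L2_H1per_quot_scale:
  assumes \<Omega>: "\<Omega> \<in> sets lebesgue" and g: "square_integrable (lebesgue_on \<Omega>) g" and Z: "Z \<in> H1per"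
  shows "(\<lambda>x y. g x * Z y) \<in> L2_H1per_quot \<Omega>"
proof -
  have meas: "strongly_measurable \<Omega> (\<lambda>x y. g x * Z y)"
    by (rule strongly_measurable_scale[OF square_integrable_measurable[OF g] Z])
  have "square_integrable (lebesgue_on \<Omega>) (\<lambda>x. quot_norm (\<lambda>y. g x * Z y))"
  proof (rule square_integrable_bound)
    show "square_integrable (lebesgue_on \<Omega>) (\<lambda>x. g x *\<^sub>R quot_norm Z)"
      by (rule square_integrable_scaleR_const[OF g])
    show "(\<lambda>x. quot_norm (\<lambda>y. g x * Z y)) \<in> borel_measurable (lebesgue_on \<Omega>)"
      by (rule quot_norm_measurable[OF \<Omega> _ meas]) (intro H1per_scale Z)
    show "AE x in lebesgue_on \<Omega>. norm (quot_norm (\<lambda>y. g x * Z y)) \<le> norm (g x *\<^sub>R quot_norm Z)"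
      using quot_norm_scale_le[OF Z] by (intro AE_I2) (simp add: quot_norm_nonneg H1per_scale Z abs_mult)
  qed
  with meas show ?thesis by (simp add: L2_H1per_quot_iff[OF \<Omega>] H1per_scale Z)
qed

subsection \<open>The bilinear form of the cell\<close>

lemma integrable_vecI:
  fixes f :: "'a \<Rightarrow> 'b::euclidean_space ^ 'n"
  assumes "\<And>i. integrable M (\<lambda>x. f x $ i)"
  shows "integrable M f"
proof -
  have "bounded_linear (axis i :: 'b \<Rightarrow> 'b ^ 'n)" for i
    unfolding linear_conv_bounded_linear[symmetric]
    by (rule linearI) (auto simp: vec_eq_iff axis_def)
  then have "integrable M (\<lambda>x. \<Sum>i\<in>UNIV. axis i (f x $ i))"
    by (intro Bochner_Integration.integrable_sum integrable_bounded_linear[of "axis _"] assms)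
  also have "(\<lambda>x. \<Sum>i\<in>UNIV. axis i (f x $ i)) = f"
    by (auto simp: fun_eq_iff vec_eq_iff axis_def if_distrib cong: if_cong)
  finally show ?thesis .
qed

lemma borel_measurable_vec_nth:
  fixes f :: "'a \<Rightarrow> real ^ 'n"
  assumes "f \<in> borel_measurable M"
  shows "(\<lambda>x. f x $ i) \<in> borel_measurable M"
  using borel_measurable_inner[OF assms borel_measurable_const[of "axis i 1"]] by (simp add: inner_axis)

locale elliptic_matrix =
  fixes A :: "heis \<Rightarrow> real ^ 2 ^ 2" and \<alpha> \<beta> :: real
  assumes measurable_entry: "\<And>i j. (\<lambda>x. A x $ i $ j) \<in> borel_measurable lebesgue"
    and \<alpha>_pos: "\<alpha> > 0" and \<beta>_pos: "\<beta> > 0"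
    and bound: "\<And>x v. norm (A x *v v) \<le> \<beta> * norm v"
    and coercive: "\<And>x v. (A x *v v) \<bullet> v \<ge> \<alpha> * (norm v)\<^sup>2"
begin

definition cell_form :: "(heis \<Rightarrow> real ^ 2) \<Rightarrow> (heis \<Rightarrow> real ^ 2) \<Rightarrow> real" where
  "cell_form v w = (LINT y|lebesgue_on Ycell. (A y *v v y) \<bullet> w y)"

lemma abs_inner_le: "\<bar>(A y *v v) \<bullet> w\<bar> \<le> \<beta> * (norm v * norm w)"
  using order_trans[OF Cauchy_Schwarz_ineq2 mult_right_mono[OF bound norm_ge_zero]] by (simp add: mult.assoc)

lemma form_nonneg: "(A y *v v) \<bullet> v \<ge> 0"
  using order_trans[OF _ coercive] \<alpha>_pos by simp

lemma integrable_cell_form: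
  assumes v: "square_integrable (lebesgue_on Ycell) v" and w: "square_integrable (lebesgue_on Ycell) w"
  shows "integrable (lebesgue_on Ycell) (\<lambda>y. (A y *v v y) \<bullet> w y)"
proof (rule Bochner_Integration.integrable_bound)
  show "integrable (lebesgue_on Ycell) (\<lambda>y. \<beta> * (norm (v y) * norm (w y)))"
    using integrable_norm_mult_norm[OF v w] by simp
  have "(\<lambda>y. A y $ i $ j * v y $ j * w y $ i) \<in> borel_measurable (lebesgue_on Ycell)" for i j
    by (intro borel_measurable_times measurable_restrict_space1[OF measurable_entry]
        borel_measurable_vec_nth square_integrable_measurable v w)
  then have "(\<lambda>y. \<Sum>i\<in>UNIV. \<Sum>j\<in>UNIV. A y $ i $ j * v y $ j * w y $ i) \<in> borel_measurable (lebesgue_on Ycell)"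
    by (intro borel_measurable_sum)
  then show "(\<lambda>y. (A y *v v y) \<bullet> w y) \<in> borel_measurable (lebesgue_on Ycell)"
    by (simp add: inner_vec_def matrix_vector_mult_def sum_distrib_right)
  show "AE y in lebesgue_on Ycell. norm ((A y *v v y) \<bullet> w y) \<le> norm (\<beta> * (norm (v y) * norm (w y)))"
    using abs_inner_le \<beta>_pos by (intro AE_I2) (simp add: abs_mult)
qed

lemma abs_cell_form_le:
  assumes v: "square_integrable (lebesgue_on Ycell) v" and w: "square_integrable (lebesgue_on Ycell) w"
  shows "\<bar>cell_form v w\<bar> \<le> \<beta> * (L2_norm (lebesgue_on Ycell) v * L2_norm (lebesgue_on Ycell) w)"
proof -
  have "\<bar>cell_form v w\<bar> \<le> (LINT y|lebesgue_on Ycell. \<bar>(A y *v v y) \<bullet> w y\<bar>)"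
    unfolding cell_form_def by (rule integral_abs_bound)
  also have "\<dots> \<le> (LINT y|lebesgue_on Ycell. \<beta> * (norm (v y) * norm (w y)))"
    using integrable_cell_form[OF v w] integrable_norm_mult_norm[OF v w] abs_inner_le
    by (intro integral_mono) auto
  also have "\<dots> \<le> \<beta> * (L2_norm (lebesgue_on Ycell) v * L2_norm (lebesgue_on Ycell) w)"
    using integral_norm_mult_norm_le[OF v w] \<beta>_pos by simp
  finally show ?thesis .
qed

lemma cell_form_cong_AE:
  assumes "AE y in lebesgue_on Ycell. v y = v' y" "AE y in lebesgue_on Ycell. w y = w' y"
  shows "cell_form v w = cell_form v' w'"
  unfolding cell_form_def
proof (rule integral_lebesgue_on_cong_AE[OF sets_Ycell])
  show "AE y in lebesgue_on Ycell. (A y *v v y) \<bullet> w y = (A y *v v' y) \<bullet> w' y"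
    using assms by eventually_elim simp
qed

lemma
  assumes v: "square_integrable (lebesgue_on Ycell) v" and v': "square_integrable (lebesgue_on Ycell) v'"
    and w: "square_integrable (lebesgue_on Ycell) w"
  shows cell_form_add_left: "cell_form (\<lambda>y. v y + v' y) w = cell_form v w + cell_form v' w"
    and cell_form_diff_left: "cell_form (\<lambda>y. v y - v' y) w = cell_form v w - cell_form v' w"
    and cell_form_diff_right: "cell_form w (\<lambda>y. v y - v' y) = cell_form w v - cell_form w v'"
  using integrable_cell_form[OF v w] integrable_cell_form[OF v' w]
    integrable_cell_form[OF w v] integrable_cell_form[OF w v']
  by (simp_all add: cell_form_def matrix_vector_right_distrib matrix_vector_mult_diff_distrib
      inner_add_left inner_diff_left inner_diff_right)

lemma cell_form_scaleR_left: "cell_form (\<lambda>y. r *\<^sub>R v y) w = r * cell_form v w"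
  by (simp add: cell_form_def matrix_vector_mult_scaleR)

definition energy :: "(heis \<Rightarrow> real) \<Rightarrow> real" where
  "energy f = cell_form (hgrad UNIV f) (hgrad UNIV f)"

lemma energy_nonneg: "energy f \<ge> 0"
  unfolding energy_def cell_form_def by (intro integral_nonneg_AE AE_I2 form_nonneg)

lemma energy_le_quot_norm:
  assumes f: "f \<in> H1per" shows "energy f \<le> \<beta> * (quot_norm f)\<^sup>2"
proof -
  let ?N = "L2_norm (lebesgue_on Ycell) (hgrad UNIV f)"
  have "energy f \<le> \<beta> * (?N * ?N)"
    unfolding energy_def by (rule order_trans[OF abs_ge_self abs_cell_form_le]) (intro H1perD f)+
  also have "\<dots> \<le> \<beta> * (quot_norm f)\<^sup>2"
    using \<beta>_pos power_mono[OF L2_norm_hgrad_le_quot_norm[OF f] L2_norm_nonneg, of 2]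
    by (simp add: power2_eq_square)
  finally show ?thesis .
qed

lemma abs_energy_diff_le:
  assumes f: "f \<in> H1per" and g: "g \<in> H1per"
  shows "\<bar>energy f - energy g\<bar> \<le> \<beta> * (quot_norm (\<lambda>y. f y - g y) * (quot_norm f + quot_norm g))"
proof -
  let ?f = "hgrad UNIV f" and ?g = "hgrad UNIV g" and ?d = "hgrad UNIV (\<lambda>y. f y - g y)"
  note fg = H1per_diff[OF f g]
  have "energy f - energy g = cell_form (\<lambda>y. ?f y - ?g y) ?f + cell_form ?g (\<lambda>y. ?f y - ?g y)"
    by (simp add: energy_def cell_form_diff_left cell_form_diff_right H1perD(5) f g)
  also have "\<dots> = cell_form ?d ?f + cell_form ?g ?d"
    by (intro arg_cong2[where f="(+)"] cell_form_cong_AE AE_symmetric[OF hgrad_diff_AE_Ycell[OF f g]] AE_I2 refl)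
  finally have "\<bar>energy f - energy g\<bar> \<le> \<bar>cell_form ?d ?f\<bar> + \<bar>cell_form ?g ?d\<bar>"
    by (simp add: abs_triangle_ineq)
  also have "\<dots> \<le> \<beta> * (L2_norm (lebesgue_on Ycell) ?d * L2_norm (lebesgue_on Ycell) ?f)
      + \<beta> * (L2_norm (lebesgue_on Ycell) ?g * L2_norm (lebesgue_on Ycell) ?d)"
    by (intro add_mono abs_cell_form_le H1perD(5) f g fg)
  also have "\<dots> \<le> \<beta> * (quot_norm (\<lambda>y. f y - g y) * quot_norm f)
      + \<beta> * (quot_norm g * quot_norm (\<lambda>y. f y - g y))"
    using \<beta>_pos by (intro add_mono mult_left_mono mult_mono L2_norm_hgrad_le_quot_norm
        L2_norm_nonneg quot_norm_nonneg f g fg) auto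
  finally show ?thesis by (simp add: algebra_simps)
qed

lemma quot_tendsto_imp_tendsto_energy:
  assumes F: "\<And>n. F n \<in> H1per" "f \<in> H1per" "quot_tendsto F f"
  shows "(\<lambda>n. energy (F n)) \<longlonglongrightarrow> energy f"
proof (rule LIM_zero_cancel, rule Lim_null_comparison)
  show "\<forall>\<^sub>F n in sequentially. norm (energy (F n) - energy f)
      \<le> \<beta> * (quot_norm (\<lambda>y. F n y - f y) * (quot_norm (F n) + quot_norm f))"
    using abs_energy_diff_le[OF F(1,2)] by (simp add: always_eventually)
  have "(\<lambda>n. \<beta> * (quot_norm (\<lambda>y. F n y - f y) * (quot_norm (F n) + quot_norm f)))
      \<longlonglongrightarrow> \<beta> * (0 * (quot_norm f + quot_norm f))"
    using F(3) unfolding quot_tendsto_def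
    by (intro tendsto_mult tendsto_add tendsto_const quot_tendsto_imp_tendsto_quot_norm F) simp
  then show "(\<lambda>n. \<beta> * (quot_norm (\<lambda>y. F n y - f y) * (quot_norm (F n) + quot_norm f))) \<longlonglongrightarrow> 0"
    by simp
qed

lemma hgrad_eq_0_if_energy_eq_0:
  assumes f: "f \<in> H1per" and "energy f = 0"
  shows "AE y in lebesgue_on Ycell. hgrad UNIV f y = 0"
proof -
  have "AE y in lebesgue_on Ycell. (A y *v hgrad UNIV f y) \<bullet> hgrad UNIV f y = 0"
    using integral_nonneg_eq_0_iff_AE[OF integrable_cell_form[OF H1perD(5)[OF f] H1perD(5)[OF f]]] assms(2)
    by (simp add: energy_def cell_form_def form_nonneg)
  then show ?thesis
  proof eventually_elim
    case (elim y)
    then have "\<alpha> * (norm (hgrad UNIV f y))\<^sup>2 \<le> 0" using coercive[of "hgrad UNIV f y" y] by simp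
    then show ?case using \<alpha>_pos by (simp add: mult_le_0_iff)
  qed
qed

lemma integrable_energy:
  assumes \<Omega>: "\<Omega> \<in> sets lebesgue" and w: "w \<in> L2_H1per_quot \<Omega>"
  shows "integrable (lebesgue_on \<Omega>) (\<lambda>x. energy (w x))"
proof (rule Bochner_Integration.integrable_bound)
  have in_H1per: "\<And>x. x \<in> \<Omega> \<Longrightarrow> w x \<in> H1per" and meas: "strongly_measurable \<Omega> w"
    using w by (auto simp: L2_H1per_quot_iff[OF \<Omega>])
  show "integrable (lebesgue_on \<Omega>) (\<lambda>x. \<beta> * (quot_norm (w x))\<^sup>2)"
    using w by (simp add: L2_H1per_quot_iff[OF \<Omega>] square_integrable_def)
  show "(\<lambda>x. energy (w x)) \<in> borel_measurable (lebesgue_on \<Omega>)"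
    by (rule borel_measurable_quot_continuous[OF \<Omega> in_H1per meas quot_tendsto_imp_tendsto_energy])
  show "AE x in lebesgue_on \<Omega>. norm (energy (w x)) \<le> norm (\<beta> * (quot_norm (w x))\<^sup>2)"
    using \<beta>_pos by (intro AE_I2) (simp add: energy_nonneg energy_le_quot_norm in_H1per)
qed

lemma hgrad_eq_0_if_integral_energy_eq_0:
  assumes \<Omega>: "\<Omega> \<in> sets lebesgue" and w: "w \<in> L2_H1per_quot \<Omega>"
    and "(LINT x|lebesgue_on \<Omega>. energy (w x)) = 0"
  shows "AE x in lebesgue_on \<Omega>. AE y in lebesgue_on Ycell. hgrad UNIV (w x) y = 0"
proof -
  have "AE x in lebesgue_on \<Omega>. energy (w x) = 0"
    using integral_nonneg_eq_0_iff_AE[OF integrable_energy[OF \<Omega> w]] assms(3) by (simp add: energy_nonneg)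
  then show ?thesis
    by (rule lebesgue_on_mono) (use w in \<open>simp add: hgrad_eq_0_if_energy_eq_0 L2_H1per_quot_iff[OF \<Omega>]\<close>)
qed

end

subsection \<open>Correctors and the effective matrix\<close>

definition cell_corrector :: "(2 \<Rightarrow> heis \<Rightarrow> real) \<Rightarrow> real ^ 2 \<Rightarrow> heis \<Rightarrow> real" where
  "cell_corrector Z v y = (\<Sum>i\<in>UNIV. Z i y * v $ i)"

lemma
  assumes Z: "\<And>i. Z i \<in> H1per"
  shows cell_corrector_in_H1per: "cell_corrector Z v \<in> H1per"
    and hgrad_cell_corrector_AE:
      "AE y in lebesgue_on Ycell. hgrad UNIV (cell_corrector Z v) y = (\<Sum>i\<in>UNIV. v $ i *\<^sub>R hgrad UNIV (Z i) y)"
proof -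
  have "cell_corrector Z v = (\<lambda>y. v $ 1 * Z 1 y + v $ 2 * Z 2 y)"
    by (simp add: cell_corrector_def fun_eq_iff sum_2 mult.commute)
  then show "cell_corrector Z v \<in> H1per"
    "AE y in lebesgue_on Ycell. hgrad UNIV (cell_corrector Z v) y = (\<Sum>i\<in>UNIV. v $ i *\<^sub>R hgrad UNIV (Z i) y)"
    using H1per_linear[OF Z Z] hgrad_linear_AE_Ycell[OF Z Z] by (simp_all add: sum_2)
qed

lemma cell_solution_in_H1per: "cell_solution A i Z \<Longrightarrow> Z \<in> H1per"
  by (simp add: cell_solution_def)

context elliptic_matrix
begin

lemma cell_form_cell_solution:
  assumes Z: "cell_solution A i Z" and \<xi>: "\<xi> \<in> H1per"
  shows "cell_form (\<lambda>y. axis i 1 + hgrad UNIV Z y) (hgrad UNIV \<xi>) = 0"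
  using assms
  by (subst cell_form_add_left)
    (auto simp: cell_solution_def cell_form_def Ycell.square_integrable_const H1perD)

lemma cell_form_cell_corrector:
  assumes Z: "\<And>i. cell_solution A i (Z i)" and \<xi>: "\<xi> \<in> H1per"
  shows "cell_form (\<lambda>y. v + hgrad UNIV (cell_corrector Z v) y) (hgrad UNIV \<xi>) = 0"
proof -
  note Z_in_H1per = cell_solution_in_H1per[OF Z]
  let ?e = "\<lambda>i y. axis i 1 + hgrad UNIV (Z i) y"
  have e: "square_integrable (lebesgue_on Ycell) (?e i)" for i
    by (intro square_integrable_add Ycell.square_integrable_const H1perD Z_in_H1per)
  have "v = v $ 1 *\<^sub>R axis 1 1 + v $ 2 *\<^sub>R axis 2 1"
    by (simp add: vec_eq_iff forall_2 axis_def)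
  then have "AE y in lebesgue_on Ycell.
      v + hgrad UNIV (cell_corrector Z v) y = v $ 1 *\<^sub>R ?e 1 y + v $ 2 *\<^sub>R ?e 2 y"
    using hgrad_cell_corrector_AE[of Z v, OF Z_in_H1per]
    by (auto simp: sum_2 scaleR_add_right elim!: eventually_mono)
  then have "cell_form (\<lambda>y. v + hgrad UNIV (cell_corrector Z v) y) (hgrad UNIV \<xi>)
      = cell_form (\<lambda>y. v $ 1 *\<^sub>R ?e 1 y + v $ 2 *\<^sub>R ?e 2 y) (hgrad UNIV \<xi>)"
    by (rule cell_form_cong_AE) simp
  also have "\<dots> = v $ 1 * cell_form (?e 1) (hgrad UNIV \<xi>) + v $ 2 * cell_form (?e 2) (hgrad UNIV \<xi>)"
    by (simp add: cell_form_add_left cell_form_scaleR_left square_integrable_scaleR e H1perD(5) \<xi>)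
  finally show ?thesis by (simp add: cell_form_cell_solution[OF Z \<xi>])
qed

lemma effective_matrix_form:
  assumes Z: "\<And>i. Z i \<in> H1per"
  shows "(effective_matrix A Z *v v) \<bullet> \<psi> = cell_form (\<lambda>y. v + hgrad UNIV (cell_corrector Z v) y) (\<lambda>y. \<psi>)"
proof -
  let ?M = "lebesgue_on Ycell" and ?D = "\<lambda>y. \<chi> i j. wX i UNIV (Z j) y :: real ^ 2 ^ 2"
  have mult_D: "(mat 1 + ?D y) *v w = w + (\<Sum>i\<in>UNIV. w $ i *\<^sub>R hgrad UNIV (Z i) y)" for y w
    unfolding matrix_vector_mult_add_rdistrib
    by (simp add: vec_eq_iff matrix_vector_mult_def[of "?D y"] hgrad_def mult.commute)
  have "integrable ?M (\<lambda>y. (A y ** (mat 1 + ?D y)) $ i $ j)" for i j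
  proof -
    have "(A y ** (mat 1 + ?D y)) $ i $ j = (A y *v (axis j 1 + hgrad UNIV (Z j) y)) \<bullet> axis i 1" for y
    proof -
      have "(A y ** (mat 1 + ?D y)) $ i $ j = ((A y ** (mat 1 + ?D y)) *v axis j 1) $ i"
        by (simp add: matrix_vector_mult_basis column_def)
      also have "\<dots> = (A y *v (axis j 1 + (\<Sum>k\<in>UNIV. axis j 1 $ k *\<^sub>R hgrad UNIV (Z k) y))) $ i"
        by (simp only: mult_D flip: matrix_vector_mul_assoc)
      also have "(\<Sum>k\<in>UNIV. axis j 1 $ k *\<^sub>R hgrad UNIV (Z k) y) = hgrad UNIV (Z j) y"
        by (simp add: axis_def if_distrib[of "\<lambda>a. a *\<^sub>R _"] cong: if_cong)
      finally show ?thesis by (simp add: inner_axis)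
    qed
    then show ?thesis
      by (simp add: integrable_cell_form square_integrable_add Ycell.square_integrable_const H1perD(5) Z)
  qed
  then have "integrable ?M (\<lambda>y. A y ** (mat 1 + ?D y))"
    by (intro integrable_vecI)
  moreover have "bounded_linear (\<lambda>B :: real ^ 2 ^ 2. (B *v v) \<bullet> \<psi>)"
    unfolding linear_conv_bounded_linear[symmetric]
    by (rule linearI)
      (simp_all add: matrix_vector_mult_add_rdistrib inner_add_left scaleR_matrix_vector_assoc[symmetric])
  ultimately have "(effective_matrix A Z *v v) \<bullet> \<psi> = (LINT y|?M. ((A y ** (mat 1 + ?D y)) *v v) \<bullet> \<psi>)"
    unfolding effective_matrix_def by (rule integral_bounded_linear[rotated, symmetric])
  also have "\<dots> = cell_form (\<lambda>y. v + (\<Sum>i\<in>UNIV. v $ i *\<^sub>R hgrad UNIV (Z i) y)) (\<lambda>y. \<psi>)"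
    by (simp only: cell_form_def mult_D flip: matrix_vector_mul_assoc)
  also have "\<dots> = cell_form (\<lambda>y. v + hgrad UNIV (cell_corrector Z v) y) (\<lambda>y. \<psi>)"
    by (rule cell_form_cong_AE) (use hgrad_cell_corrector_AE[of Z v, OF Z] in \<open>auto elim: eventually_mono\<close>)
  finally show ?thesis .
qed

end

subsection \<open>The two-scale problem\<close>

lemma zero_in_H1: "\<Omega> \<in> sets lebesgue \<Longrightarrow> (\<lambda>x. 0) \<in> H1 \<Omega>"
  by (auto simp: H1_def L2_def is_weak_X_const intro!: exI[of _ "\<lambda>x. 0"])

lemma H1_imp_square_integrable_wX:
  assumes "open \<Omega>" "u \<in> H1 \<Omega>"
  shows "square_integrable (lebesgue_on \<Omega>) (wX i \<Omega> u)"
proof -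
  obtain g where "is_weak_X i \<Omega> u g" "g \<in> L2 \<Omega>" using assms(2) by (auto simp: H1_def)
  then show ?thesis
    using wX_in_L2[OF assms(1) _ subset_refl] assms(1) by (simp add: L2_iff_square_integrable)
qed

locale two_scale_problem = elliptic_matrix A \<alpha> \<beta>
  for A :: "heis \<Rightarrow> real ^ 2 ^ 2" and \<alpha> \<beta> :: real +
  fixes \<Omega> :: "heis set" and f u :: "heis \<Rightarrow> real" and u1 :: "heis \<Rightarrow> heis \<Rightarrow> real"
    and Z :: "2 \<Rightarrow> heis \<Rightarrow> real"
  assumes open_\<Omega>: "open \<Omega>"
    and two_scale: "two_scale_solution \<Omega> A f u u1"
    and cell: "\<And>i. cell_solution A i (Z i)"
begin

lemma sets_\<Omega>: "\<Omega> \<in> sets lebesgue"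
  using open_\<Omega> by simp

lemma u_in_H1: "u \<in> H1 \<Omega>" and u1_in_L2: "u1 \<in> L2_H1per_quot \<Omega>"
  using two_scale by (simp_all add: two_scale_solution_def)

lemma two_scale_equation:
  assumes "\<phi> \<in> H1 \<Omega>" "\<phi>1 \<in> L2_H1per_quot \<Omega>"
  shows "(LINT x|lebesgue_on \<Omega>.
      cell_form (\<lambda>y. hgrad \<Omega> u x + hgrad UNIV (u1 x) y) (\<lambda>y. hgrad \<Omega> \<phi> x + hgrad UNIV (\<phi>1 x) y))
    + measure lebesgue Ycell * (LINT x|lebesgue_on \<Omega>. u x * \<phi> x)
    = measure lebesgue Ycell * (LINT x|lebesgue_on \<Omega>. f x * \<phi> x)"
  using two_scale assms
  by (simp add: two_scale_solution_def cell_form_def measure_restrict_space sets_Ycell mult.assoc)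

definition defect :: "heis \<Rightarrow> heis \<Rightarrow> real" where
  "defect x y = u1 x y - cell_corrector Z (hgrad \<Omega> u x) y"

lemma defect_in_L2_H1per_quot: "defect \<in> L2_H1per_quot \<Omega>"
proof -
  have "(\<lambda>x y. (u1 x y - wX 1 \<Omega> u x * Z 1 y) - wX 2 \<Omega> u x * Z 2 y) \<in> L2_H1per_quot \<Omega>"
    by (intro L2_H1per_quot_diff L2_H1per_quot_scale sets_\<Omega> u1_in_L2 cell_solution_in_H1per[OF cell]
        H1_imp_square_integrable_wX[OF open_\<Omega> u_in_H1])
  also have "(\<lambda>x y. (u1 x y - wX 1 \<Omega> u x * Z 1 y) - wX 2 \<Omega> u x * Z 2 y) = defect"
    by (simp add: fun_eq_iff defect_def cell_corrector_def hgrad_def sum_2 mult.commute)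
  finally show ?thesis .
qed

lemma defect_in_H1per: "x \<in> \<Omega> \<Longrightarrow> defect x \<in> H1per"
  using defect_in_L2_H1per_quot by (simp add: L2_H1per_quot_iff[OF sets_\<Omega>])

lemma hgrad_u1_AE:
  assumes "x \<in> \<Omega>"
  shows "AE y in lebesgue_on Ycell.
    hgrad UNIV (u1 x) y = hgrad UNIV (cell_corrector Z (hgrad \<Omega> u x)) y + hgrad UNIV (defect x) y"
proof -
  have "u1 x = (\<lambda>y. cell_corrector Z (hgrad \<Omega> u x) y + defect x y)" by (simp add: defect_def)
  then show ?thesis
    using hgrad_add_AE_Ycell[OF _ defect_in_H1per[OF assms]]
      cell_corrector_in_H1per[of Z, OF cell_solution_in_H1per[OF cell]] by simp
qed

lemma cell_form_defect:
  assumes x: "x \<in> \<Omega>"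
  shows "cell_form (\<lambda>y. hgrad \<Omega> u x + hgrad UNIV (u1 x) y) (hgrad UNIV (defect x)) = energy (defect x)"
proof -
  let ?N = "\<lambda>y. hgrad \<Omega> u x + hgrad UNIV (cell_corrector Z (hgrad \<Omega> u x)) y"
  have "AE y in lebesgue_on Ycell. hgrad \<Omega> u x + hgrad UNIV (u1 x) y = ?N y + hgrad UNIV (defect x) y"
    using hgrad_u1_AE[OF x] by eventually_elim simp
  then have "cell_form (\<lambda>y. hgrad \<Omega> u x + hgrad UNIV (u1 x) y) (hgrad UNIV (defect x))
      = cell_form (\<lambda>y. ?N y + hgrad UNIV (defect x) y) (hgrad UNIV (defect x))"
    by (rule cell_form_cong_AE) simp
  also have "\<dots> = cell_form ?N (hgrad UNIV (defect x)) + energy (defect x)"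
    unfolding energy_def
    by (intro cell_form_add_left square_integrable_add Ycell.square_integrable_const H1perD(5) defect_in_H1per x
        cell_corrector_in_H1per cell_solution_in_H1per[OF cell])
  finally show ?thesis by (simp add: cell_form_cell_corrector[of Z, OF cell defect_in_H1per[OF x]])
qed

lemma integral_energy_defect_eq_0: "(LINT x|lebesgue_on \<Omega>. energy (defect x)) = 0"
proof -
  have "AE x in lebesgue_on \<Omega>. cell_form (\<lambda>y. hgrad \<Omega> u x + hgrad UNIV (u1 x) y)
      (\<lambda>y. hgrad \<Omega> (\<lambda>x. 0) x + hgrad UNIV (defect x) y) = energy (defect x)"
    using hgrad_const_AE[OF open_\<Omega>, of 0] by (rule lebesgue_on_mono) (simp add: cell_form_defect)
  from integral_lebesgue_on_cong_AE[OF sets_\<Omega> this] show ?thesis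
    using two_scale_equation[OF zero_in_H1[OF sets_\<Omega>] defect_in_L2_H1per_quot] by simp
qed

lemma hgrad_defect_eq_0: "AE x in lebesgue_on \<Omega>. AE y in lebesgue_on Ycell. hgrad UNIV (defect x) y = 0"
  by (rule hgrad_eq_0_if_integral_energy_eq_0[OF sets_\<Omega> defect_in_L2_H1per_quot integral_energy_defect_eq_0])

theorem u1_quot_eq_cell_corrector: "AE x in lebesgue_on \<Omega>. quot_eq (u1 x) (cell_corrector Z (hgrad \<Omega> u x))"
  using hgrad_defect_eq_0
proof (rule lebesgue_on_mono)
  fix x assume x: "x \<in> \<Omega>" and "AE y in lebesgue_on Ycell. hgrad UNIV (defect x) y = 0"
  then obtain c where "AE y in lebesgue. defect x y = c"
    using AE_const_if_hgrad_eq_0[OF defect_in_H1per] by blast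
  then have "AE y in lebesgue. u1 x y = cell_corrector Z (hgrad \<Omega> u x) y + c"
    by eventually_elim (simp add: defect_def)
  then show "quot_eq (u1 x) (cell_corrector Z (hgrad \<Omega> u x))" by (auto simp: quot_eq_def)
qed

theorem effective_equation:
  assumes \<phi>: "\<phi> \<in> H1 \<Omega>"
  shows "(LINT x|lebesgue_on \<Omega>. (effective_matrix A Z *v hgrad \<Omega> u x) \<bullet> hgrad \<Omega> \<phi> x)
      + measure lebesgue Ycell * (LINT x|lebesgue_on \<Omega>. u x * \<phi> x)
    = measure lebesgue Ycell * (LINT x|lebesgue_on \<Omega>. f x * \<phi> x)"
proof -
  have "AE x in lebesgue_on \<Omega>.
      cell_form (\<lambda>y. hgrad \<Omega> u x + hgrad UNIV (u1 x) y) (\<lambda>y. hgrad \<Omega> \<phi> x + hgrad UNIV (\<lambda>y. 0) y)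
      = (effective_matrix A Z *v hgrad \<Omega> u x) \<bullet> hgrad \<Omega> \<phi> x"
    using hgrad_defect_eq_0
  proof (rule lebesgue_on_mono)
    fix x assume "x \<in> \<Omega>" and defect_0: "AE y in lebesgue_on Ycell. hgrad UNIV (defect x) y = 0"
    have "AE y in lebesgue_on Ycell.
        hgrad \<Omega> u x + hgrad UNIV (u1 x) y = hgrad \<Omega> u x + hgrad UNIV (cell_corrector Z (hgrad \<Omega> u x)) y"
      using hgrad_u1_AE[OF \<open>x \<in> \<Omega>\<close>] defect_0 by eventually_elim simp
    moreover have "AE y in lebesgue_on Ycell. hgrad \<Omega> \<phi> x + hgrad UNIV (\<lambda>y. 0) y = hgrad \<Omega> \<phi> x"
      using hgrad_const_AE_Ycell[of 0] by eventually_elim simp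
    ultimately show "cell_form (\<lambda>y. hgrad \<Omega> u x + hgrad UNIV (u1 x) y) (\<lambda>y. hgrad \<Omega> \<phi> x + hgrad UNIV (\<lambda>y. 0) y)
      = (effective_matrix A Z *v hgrad \<Omega> u x) \<bullet> hgrad \<Omega> \<phi> x"
      unfolding effective_matrix_form[of Z, OF cell_solution_in_H1per[OF cell]] by (rule cell_form_cong_AE)
  qed
  note effective_form = integral_lebesgue_on_cong_AE[OF sets_\<Omega> this]
  have "(\<lambda>x y. 0) \<in> L2_H1per_quot \<Omega>"
    using L2_H1per_quot_diff[OF sets_\<Omega> u1_in_L2 u1_in_L2] by simp
  from two_scale_equation[OF \<phi> this] show ?thesis unfolding effective_form .
qed

end

theorem mainTheorem3:
  fixes \<Omega> :: "heis set"
    and f u :: "heis \<Rightarrow> real"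
    and A :: "heis \<Rightarrow> real ^ 2 ^ 2"
    and \<alpha> \<beta> :: real
    and u1 :: "heis \<Rightarrow> heis \<Rightarrow> real"
    and Z :: "2 \<Rightarrow> heis \<Rightarrow> real"
  assumes "open \<Omega>" and "connected \<Omega>" and "\<Omega> \<noteq> {}" and "bounded \<Omega>"
    and "f \<in> L2 \<Omega>"
    and "\<And>i j. bounded (range (\<lambda>x. A x $ i $ j))"
    and "\<And>i j. (\<lambda>x. A x $ i $ j) \<in> borel_measurable lebesgue"
    and "\<And>i j. Yperiodic (\<lambda>x. A x $ i $ j)"
    and "\<alpha> > 0" and "\<beta> > 0"
    and "\<And>x v. norm (A x *v v) \<le> \<beta> * norm v"
    and "\<And>x v. (A x *v v) \<bullet> v \<ge> \<alpha> * (norm v)\<^sup>2"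
    and "two_scale_solution \<Omega> A f u u1"
    and "\<And>i. cell_solution A i (Z i)"
  shows "(AE x in lebesgue_on \<Omega>. quot_eq (u1 x) (\<lambda>y. \<Sum>i\<in>UNIV. Z i y * wX i \<Omega> u x)) \<and>
    (\<forall>\<phi>\<in>H1 \<Omega>.
       (LINT x|lebesgue_on \<Omega>. (effective_matrix A Z *v hgrad \<Omega> u x) \<bullet> hgrad \<Omega> \<phi> x)
       + measure lebesgue Ycell * (LINT x|lebesgue_on \<Omega>. u x * \<phi> x)
       = measure lebesgue Ycell * (LINT x|lebesgue_on \<Omega>. f x * \<phi> x)) \<and>
    weak_neumann_solution \<Omega> (effective_matrix A Z) (measure lebesgue Ycell)
      (\<lambda>x. measure lebesgue Ycell * f x) u"
proof -
  interpret two_scale_problem A \<alpha> \<beta> \<Omega> f u u1 Z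
    by unfold_locales (rule assms)+
  have "cell_corrector Z (hgrad \<Omega> u x) = (\<lambda>y. \<Sum>i\<in>UNIV. Z i y * wX i \<Omega> u x)" for x
    by (simp add: cell_corrector_def fun_eq_iff hgrad_def)
  moreover have "weak_neumann_solution \<Omega> (effective_matrix A Z) (measure lebesgue Ycell)
      (\<lambda>x. measure lebesgue Ycell * f x) u"
    unfolding weak_neumann_solution_def using u_in_H1 effective_equation by (simp add: mult.assoc)
  ultimately show ?thesis
    using u1_quot_eq_cell_corrector effective_equation by simp
qed

end
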